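(* Let $n\ge 1$, $s>0$ and $\lambda>1$. Then, for every $x\in\mathbb{R}^n\setminus\{0\}$, $$K_{s+\ln}^{\lambda}(x)=\int_s^\infty G^\lambda_{\alpha}(x)\,d\alpha,$$ and this function belongs to $L^1(\mathbb{R}^n)$. Equivalently, $$K_{s+\ln}^{\lambda}(x)=\int_s^\infty \frac{1}{\Gamma(\alpha)}\int_0^\infty e^{-\lambda t}\,t^{\alpha-1}\,p_t(x)\,dt\,d\alpha .$$ (That is, the tempered distribution $K_{s+\ln}^\lambda$ is the one induced by the function on the right-hand side.)
   Context: The Fourier transform on $\mathbb{R}^n$ is $\widehat f(\xi)=\int_{\mathbb{R}^n}f(x)e^{-2\pi i x\cdot\xi}\,dx$, extended to tempered distributions $\mathcal S'(\mathbb R^n)$. For $s>0$, $\lambda>1$, the logarithmic Bessel kernel $K_{s+\ln}^{\lambda}$ is the tempered distribution whose Fourier transform is $$\widehat{K_{s+\ln}^{\lambda}}(\xi)=\frac{1}{(\lambda+4\pi^2|\xi|^2)^s\,\ln(\lambda+4\pi^2|\xi|^2)},\qquad \xi\in\mathbb{R}^n.$$ The Gaussian heat kernel is $p_t(x)=(4\pi t)^{-n/2}e^{-|x|^2/(4t)}$, $t>0$. For $\alpha>0$, the shifted Bessel kernel $G^\lambda_\alpha$ is the tempered distribution with Fourier transform $(\lambda+4\pi^2|\xi|^2)^{-\alpha}$, given pointwise by $$G^\lambda_\alpha(x)=\frac{1}{\Gamma(\alpha)}\int_0^\infty e^{-\lambda t}\,t^{\alpha-1}\,p_t(x)\,dt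 .$$ *)

theory Defs
  imports "HOL-Analysis.Analysis"
begin

text \<open>
  Iterated partial derivatives. A list of basis vectors plays the role of a multi-index; on
  smooth functions the order of the list is immaterial.
\<close>

primrec iter_partial ::
    "'a list \<Rightarrow> ('a::euclidean_space \<Rightarrow> complex) \<Rightarrow> 'a \<Rightarrow> complex" where
  "iter_partial [] f = f"
| "iter_partial (b # bs) f = (\<lambda>x. frechet_derivative (iter_partial bs f) (at x) b)"

text \<open>
  The Schwartz space. Differentiability of all the iterated partial derivatives is smoothness.
\<close>

definition schwartz :: "('a::euclidean_space \<Rightarrow> complex) set" where
  "schwartz = {f. \<forall>bs. set bs \<subseteq> Basis \<longrightarrow>
      (\<forall>x. iter_partial bs f differentiable at x) \<and>
      (\<forall>k::nat. bdd_above (range (\<lambda>x. norm x ^ k * cmod (iter_partial bs f x))))}"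

definition schwartz_seminorm ::
    "nat \<Rightarrow> 'a list \<Rightarrow> ('a::euclidean_space \<Rightarrow> complex) \<Rightarrow> real" where
  "schwartz_seminorm k bs f = (SUP x. norm x ^ k * cmod (iter_partial bs f x))"

text \<open>The locally convex topology defined by the seminorms, with carrier \<^const>\<open>schwartz\<close>.\<close>

definition schwartz_topology :: "('a::euclidean_space \<Rightarrow> complex) topology" where
  "schwartz_topology = topology_generated_by
     {{g \<in> schwartz. schwartz_seminorm k bs (\<lambda>x. g x - f x) < e} | k bs f e.
        set bs \<subseteq> Basis \<and> f \<in> schwartz \<and> e > 0}"

text \<open>
  Tempered distributions: continuous linear functionals on the Schwartz space. They are taken to
  be extensional (with value \<^const>\<open>undefined\<close> off the Schwartz space), so that HOL equality of
  functionals is equality of distributions.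
\<close>

definition tempered_distribution ::
    "(('a::euclidean_space \<Rightarrow> complex) \<Rightarrow> complex) \<Rightarrow> bool" where
  "tempered_distribution T \<longleftrightarrow>
     T \<in> extensional schwartz \<and>
     (\<forall>f\<in>schwartz. \<forall>g\<in>schwartz. \<forall>a b. T (\<lambda>x. a * f x + b * g x) = a * T f + b * T g) \<and>
     continuous_map schwartz_topology euclidean T"

definition induced_distribution ::
    "('a::euclidean_space \<Rightarrow> complex) \<Rightarrow> (('a \<Rightarrow> complex) \<Rightarrow> complex)" where
  "induced_distribution u = (\<lambda>f\<in>schwartz. LINT x|lborel. u x * f x)"

definition fourier_transform ::
    "('a::euclidean_space \<Rightarrow> complex) \<Rightarrow> 'a \<Rightarrow> complex" where
  "fourier_transform f \<xi> =
     (LINT x|lborel. f x * exp (- 2 * of_real pi * \<i> * of_real (x \<bullet> \<xi>)))"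

definition fourier_distribution ::
    "(('a::euclidean_space \<Rightarrow> complex) \<Rightarrow> complex) \<Rightarrow> (('a \<Rightarrow> complex) \<Rightarrow> complex)" where
  "fourier_distribution T = (\<lambda>f\<in>schwartz. T (fourier_transform f))"

definition log_bessel_symbol :: "real \<Rightarrow> real \<Rightarrow> 'a::euclidean_space \<Rightarrow> real" where
  "log_bessel_symbol s lam \<xi> =
     1 / ((lam + 4 * pi\<^sup>2 * (norm \<xi>)\<^sup>2) powr s * ln (lam + 4 * pi\<^sup>2 * (norm \<xi>)\<^sup>2))"

text \<open>
  The kernel is a distribution, characterised by its Fourier transform (the Fourier transform
  being a bijection of the tempered distributions).
\<close>

definition log_bessel_kernel ::
    "real \<Rightarrow> real \<Rightarrow> (('a::euclidean_space \<Rightarrow> complex) \<Rightarrow> complex)" where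
  "log_bessel_kernel s lam =
     (THE K. tempered_distribution K \<and>
        fourier_distribution K =
          induced_distribution (\<lambda>\<xi>. complex_of_real (log_bessel_symbol s lam \<xi>)))"

definition heat_kernel :: "real \<Rightarrow> 'a::euclidean_space \<Rightarrow> real" where
  "heat_kernel t x =
     (4 * pi * t) powr (- real DIM('a) / 2) * exp (- (norm x)\<^sup>2 / (4 * t))"

text \<open>
  The shifted Bessel kernel as a pointwise defined function. The integral diverges at \<open>x = 0\<close>
  for small \<open>\<alpha>\<close>, so the value there carries no meaning in general.
\<close>

definition bessel_kernel :: "real \<Rightarrow> real \<Rightarrow> 'a::euclidean_space \<Rightarrow> real" where
  "bessel_kernel lam \<alpha> x =
     1 / Gamma \<alpha> *
       (LINT t:{0<..}|lborel. exp (- lam * t) * t powr (\<alpha> - 1) * heat_kernel t x)"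

end

theory Submission
  imports Defs "HOL-Probability.Characteristic_Functions" "HOL-Probability.Sinc_Integral"
begin

text \<open>
  On the Fourier side the claim is the elementary identity
  \<open>\<integral>\<^sub>s\<^sup>\<infinity> c powr - \<alpha> d\<alpha> = c powr - s / ln c\<close> for \<open>c = lam + 4 \<pi>\<^sup>2 (norm \<xi>)\<^sup>2 > 1\<close>: the powers on the left are
  the transforms of the Bessel kernels, and the right-hand side is the symbol of the logarithmic
  kernel. Since the Bessel kernels are nonnegative and have the masses \<open>lam powr - \<alpha>\<close>, which are
  integrable in \<open>\<alpha>\<close>, Tonelli's theorem shows that their integral over \<open>\<alpha>\<close> is in \<open>L\<^sup>1\<close>, and Fubini's
  theorem computes its Fourier transform. The same argument, with the time in place of the order
  and the Gamma integral in place of the exponential one, derives the transforms of the Bessel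
  kernels from that of the heat kernel; \<open>fourier_integral_mixture\<close> serves both. Pointwise
  convergence away from the origin holds because there the heat kernel is bounded uniformly in
  time (\<open>heat_kernel_bounded\<close>).

  It remains to pass from functions to distributions. The logarithmic kernel is the tempered
  distribution with a prescribed Fourier transform, so it has to be known that such a distribution
  is unique and that the function found above induces one. The Fourier transform of a distribution
  is given by duality; the existence part thus needs that the transform preserves the Schwartz
  space (\<open>schwartz_fourier_transform\<close>) together with the multiplication formula, and the uniqueness
  part that it maps the Schwartz space onto itself, which follows from \<open>fourier_inversion\<close>.
\<close>

section \<open>Fourier integrals of Gaussians\<close>

lemma has_bochner_integral_lborel_prod:
  fixes f :: "'a::euclidean_space \<Rightarrow> real \<Rightarrow> 'b::{real_normed_field,banach,second_countable_topology}"
  assumes f: "\<And>b. b \<in> Basis \<Longrightarrow> has_bochner_integral lborel (f b) (I b)"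
  shows "has_bochner_integral lborel (\<lambda>x::'a. \<Prod>b\<in>Basis. f b (x \<bullet> b)) (\<Prod>b\<in>Basis. I b)"
proof -
  interpret product_sigma_finite "\<lambda>_::'a. lborel :: real measure" ..
  have f_int: "integrable lborel (f b)" if "b \<in> Basis" for b
    using f[OF that] by (simp add: has_bochner_integral_iff)
  have [measurable]: "f b \<in> borel_measurable borel" if "b \<in> Basis" for b
    using borel_measurable_integrable[OF f_int[OF that]] by simp
  have eq: "(\<lambda>p. \<Prod>b\<in>Basis. f b ((\<Sum>b'\<in>Basis. p b' *\<^sub>R b') \<bullet> b)) = (\<lambda>p. \<Prod>b\<in>Basis. f b (p b))"
    by (intro ext prod.cong refl) simp
  have "integrable (\<Pi>\<^sub>M b\<in>Basis. lborel) (\<lambda>p. \<Prod>b\<in>Basis. f b (p b))"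
    by (rule product_integrable_prod) (use f_int in auto)
  moreover have "(\<integral>p. (\<Prod>b\<in>Basis. f b (p b)) \<partial>(\<Pi>\<^sub>M b\<in>Basis. lborel)) = (\<Prod>b\<in>Basis. I b)"
    by (subst product_integral_prod)
      (use f in \<open>auto intro!: prod.cong f_int simp: has_bochner_integral_iff\<close>)
  ultimately have "has_bochner_integral (\<Pi>\<^sub>M b\<in>Basis. lborel)
      (\<lambda>p. \<Prod>b\<in>Basis. f b ((\<Sum>b'\<in>Basis. p b' *\<^sub>R b') \<bullet> b)) (\<Prod>b\<in>Basis. I b)"
    by (simp add: eq has_bochner_integral_iff)
  then show ?thesis
    by (subst lborel_eq) (rule has_bochner_integral_distr, auto)
qed

lemma has_bochner_integral_lborel_affine:
  fixes f :: "'a::euclidean_space \<Rightarrow> 'b::{banach,second_countable_topology}"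
  assumes c: "c \<noteq> 0" and f: "has_bochner_integral lborel f I"
  shows "has_bochner_integral lborel (\<lambda>x. f (t + c *\<^sub>R x)) (I /\<^sub>R \<bar>c\<bar> ^ DIM('a))"
proof -
  have [measurable]: "f \<in> borel_measurable borel"
    using f by (auto simp: has_bochner_integral_iff)
  let ?M = "distr lborel borel (\<lambda>x::'a. t + c *\<^sub>R x)"
  have D: "lborel = density ?M (\<lambda>_. ennreal (\<bar>c\<bar> ^ DIM('a)))"
    using lborel_affine[OF c, of t] by (simp add: ennreal_power)
  have "integrable (density ?M (\<lambda>_. ennreal (\<bar>c\<bar> ^ DIM('a)))) f"
    "(\<integral>x. f x \<partial>density ?M (\<lambda>_. ennreal (\<bar>c\<bar> ^ DIM('a)))) = I"
    using f D by (simp_all add: has_bochner_integral_iff)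
  then have "integrable lborel (\<lambda>x. \<bar>c\<bar> ^ DIM('a) *\<^sub>R f (t + c *\<^sub>R x))"
    "(\<integral>x. \<bar>c\<bar> ^ DIM('a) *\<^sub>R f (t + c *\<^sub>R x) \<partial>lborel) = I"
    by (simp_all add: integrable_density integral_density integrable_distr_eq integral_distr)
  then have "has_bochner_integral lborel
      (\<lambda>x. inverse (\<bar>c\<bar> ^ DIM('a)) *\<^sub>R \<bar>c\<bar> ^ DIM('a) *\<^sub>R f (t + c *\<^sub>R x)) (I /\<^sub>R \<bar>c\<bar> ^ DIM('a))"
    by (intro has_bochner_integral_scaleR_right) (simp add: has_bochner_integral_iff)
  then show ?thesis using c by simp
qed

text \<open>
  The character \<open>x \<mapsto> exp (- 2 \<pi> i x \<cdot> \<xi>)\<close>. Statements of the form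
  \<open>has_bochner_integral lborel (\<lambda>x. u x * wave \<xi> x) v\<close> say at once that \<open>u\<close> is integrable and that its
  Fourier transform has the value \<open>v\<close> at \<open>\<xi>\<close>; the case \<open>\<xi> = 0\<close>, where the character is constantly \<open>1\<close>,
  records the total mass.
\<close>

definition wave :: "'a::euclidean_space \<Rightarrow> 'a \<Rightarrow> complex" where
  "wave \<xi> x = exp (- 2 * of_real pi * \<i> * of_real (x \<bullet> \<xi>))"

lemma fourier_transform_wave: "fourier_transform f \<xi> = (LINT x|lborel. f x * wave \<xi> x)"
  by (simp add: fourier_transform_def wave_def)

lemma wave_iexp: "wave \<xi> x = iexp (- (2 * pi * (x \<bullet> \<xi>)))"
  by (simp add: wave_def algebra_simps)

lemma norm_wave [simp]: "cmod (wave \<xi> x) = 1"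
  unfolding wave_iexp by (simp only: norm_exp_i_times)

lemma measurable_wave [measurable (raw)]:
  assumes [measurable]: "f \<in> borel_measurable M" "g \<in> borel_measurable M"
  shows "(\<lambda>p. wave (f p) (g p)) \<in> borel_measurable M"
  unfolding wave_def by measurable

lemma wave_commute: "wave \<xi> x = wave x \<xi>"
  by (simp add: wave_def inner_commute)

lemma wave_add: "wave \<xi> (x + y) = wave \<xi> x * wave \<xi> y"
  unfolding wave_def mult_exp_exp by (rule arg_cong[of _ _ exp]) (simp add: inner_add_left algebra_simps)

lemma wave_eq_prod: "wave \<xi> x = (\<Prod>b\<in>Basis. wave (\<xi> \<bullet> b) (x \<bullet> b))"
  by (simp add: wave_def exp_sum[symmetric] euclidean_inner[of x \<xi>] sum_distrib_left)

text \<open>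
  The characteristic function of the standard normal distribution, rescaled by \<open>sqrt (2 * a)\<close>.
\<close>

lemma fourier_integral_gaussian_real:
  fixes a y :: real
  assumes "a > 0"
  shows "has_bochner_integral lborel (\<lambda>x. complex_of_real (exp (- a * x\<^sup>2)) * wave y x)
           (complex_of_real (sqrt (pi / a) * exp (- pi\<^sup>2 * y\<^sup>2 / a)))"
proof -
  define c where "c = sqrt (2 * a)"
  define r where "r = - (2 * pi * y / c)"
  have c: "c > 0" "c\<^sup>2 = 2 * a" using assms by (auto simp: c_def)
  have int: "integrable lborel (\<lambda>x. complex_of_real (std_normal_density x) * iexp (r * x))"
    by (rule Bochner_Integration.integrable_bound[OF integrable_normal_density[of 1 0]])
      (auto simp: norm_mult simp del: of_real_mult)
  have "(\<integral>x. complex_of_real (std_normal_density x) * iexp (r * x) \<partial>lborel)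
      = char std_normal_distribution r"
    unfolding char_def by (subst integral_density) (auto simp: scaleR_conv_of_real)
  also have "\<dots> = of_real (exp (- r\<^sup>2 / 2))"
    by (simp add: char_std_normal_distribution)
  finally have "has_bochner_integral lborel
      (\<lambda>x. complex_of_real (std_normal_density x) * iexp (r * x)) (of_real (exp (- r\<^sup>2 / 2)))"
    using int by (simp add: has_bochner_integral_iff)
  from has_bochner_integral_mult_right[OF has_bochner_integral_lborel_affine[OF _ this, of c 0],
      of "of_real (sqrt (2 * pi))"] c
  have *: "has_bochner_integral lborel
      (\<lambda>x. of_real (sqrt (2 * pi)) * (complex_of_real (std_normal_density (c * x)) * iexp (r * (c * x))))
      (of_real (sqrt (2 * pi)) * (of_real (exp (- r\<^sup>2 / 2)) /\<^sub>R c))"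
    by simp
  have "of_real (sqrt (2 * pi)) * (complex_of_real (std_normal_density (c * x)) * iexp (r * (c * x)))
      = complex_of_real (exp (- a * x\<^sup>2)) * wave y x" for x
  proof -
    have "sqrt (2 * pi) * std_normal_density (c * x) = exp (- a * x\<^sup>2)"
      using c by (simp add: std_normal_density_def power_mult_distrib)
    moreover have "iexp (r * (c * x)) = wave y x"
      using c unfolding wave_iexp r_def by (simp add: field_simps)
    moreover have "of_real (sqrt (2 * pi)) * (complex_of_real (std_normal_density (c * x)) * z)
        = complex_of_real (sqrt (2 * pi) * std_normal_density (c * x)) * z" for z
      by simp
    ultimately show ?thesis by (simp only:)
  qed
  moreover have "of_real (sqrt (2 * pi)) * (of_real (exp (- r\<^sup>2 / 2)) /\<^sub>R c)
      = complex_of_real (sqrt (pi / a) * exp (- pi\<^sup>2 * y\<^sup>2 / a))"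
  proof -
    have "r\<^sup>2 / 2 = pi\<^sup>2 * y\<^sup>2 / a"
      using c assms by (simp add: r_def power_divide power_mult_distrib field_simps)
    moreover have "sqrt (2 * pi) / c = sqrt (pi / a)"
      by (simp add: c_def real_sqrt_divide real_sqrt_mult)
    ultimately have "sqrt (2 * pi) / c * exp (- (r\<^sup>2 / 2)) = sqrt (pi / a) * exp (- (pi\<^sup>2 * y\<^sup>2 / a))"
      by (simp only:)
    moreover have "of_real (sqrt (2 * pi)) * (of_real (exp (- r\<^sup>2 / 2)) /\<^sub>R c)
        = complex_of_real (sqrt (2 * pi) / c * exp (- (r\<^sup>2 / 2)))"
      unfolding scaleR_conv_of_real divide_inverse
      by (simp only: of_real_mult mult_minus_left mult_minus_right mult_ac)
    ultimately show ?thesis by (simp only: minus_divide_left mult_minus_left)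
  qed
  ultimately show ?thesis using * by simp
qed

text \<open>
  Both the Gaussian and the character are products over the coordinates, so the integral
  factorises into one-dimensional ones.
\<close>

lemma fourier_integral_gaussian:
  fixes \<xi> :: "'a::euclidean_space"
  assumes "a > 0"
  shows "has_bochner_integral lborel (\<lambda>x. complex_of_real (exp (- a * (norm x)\<^sup>2)) * wave \<xi> x)
           (complex_of_real (sqrt (pi / a) ^ DIM('a) * exp (- pi\<^sup>2 * (norm \<xi>)\<^sup>2 / a)))"
proof -
  have norm_sq: "(norm x)\<^sup>2 = (\<Sum>b\<in>Basis. (x \<bullet> b)\<^sup>2)" for x :: 'a
    unfolding power2_norm_eq_inner by (subst euclidean_inner) (simp add: power2_eq_square)
  have "(\<Prod>b\<in>Basis. complex_of_real (exp (- a * (x \<bullet> b)\<^sup>2)) * wave (\<xi> \<bullet> b) (x \<bullet> b))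
      = complex_of_real (exp (- a * (norm x)\<^sup>2)) * wave \<xi> x" for x
    by (simp add: prod.distrib wave_eq_prod[of \<xi> x] norm_sq sum_distrib_left exp_sum[symmetric]
        sum_negf flip: of_real_prod)
  moreover have "(\<Prod>b\<in>(Basis::'a set). complex_of_real (sqrt (pi / a) * exp (- pi\<^sup>2 * (\<xi> \<bullet> b)\<^sup>2 / a)))
      = complex_of_real (sqrt (pi / a) ^ DIM('a) * exp (- pi\<^sup>2 * (norm \<xi>)\<^sup>2 / a))"
    by (simp add: prod.distrib norm_sq sum_distrib_left exp_sum[symmetric] sum_negf
        sum_divide_distrib flip: of_real_prod of_real_mult)
  ultimately show ?thesis
    using has_bochner_integral_lborel_prod[where 'a='a,
        OF fourier_integral_gaussian_real[OF assms], of "\<lambda>b. \<xi> \<bullet> b"] by simp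
qed

text \<open>
  The normalisation \<open>(4 * \<pi> * t) powr (- n / 2)\<close> of the heat kernel is exactly what cancels the constant in the
  Fourier integral of the Gaussian with exponent \<open>1 / (4 t)\<close>.
\<close>

lemma fourier_integral_heat_kernel:
  fixes \<xi> :: "'a::euclidean_space"
  assumes t: "t > 0"
  shows "has_bochner_integral lborel (\<lambda>x. complex_of_real (heat_kernel t x) * wave \<xi> x)
           (complex_of_real (exp (- (4 * pi\<^sup>2 * (norm \<xi>)\<^sup>2) * t)))"
proof -
  define N where "N = (4 * pi * t) powr (- real DIM('a) / 2)"
  have "N * sqrt (pi / (1 / (4 * t))) ^ DIM('a) = 1"
  proof -
    have "sqrt (pi / (1 / (4 * t))) = (4 * pi * t) powr (1/2)"
      using t by (simp add: powr_half_sqrt mult_ac)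
    then show ?thesis using t by (simp add: N_def powr_realpow[symmetric] powr_powr powr_add[symmetric])
  qed
  then have *: "N * (sqrt (pi / (1 / (4 * t))) ^ DIM('a) * z) = z" for z
    by (metis mult.assoc mult_1)
  have "exp (- pi\<^sup>2 * (norm \<xi>)\<^sup>2 / (1 / (4 * t))) = exp (- (4 * pi\<^sup>2 * (norm \<xi>)\<^sup>2) * t)"
    by (simp add: mult_ac)
  then have "has_bochner_integral lborel
      (\<lambda>x. complex_of_real N * (complex_of_real (exp (- (1 / (4 * t)) * (norm x)\<^sup>2)) * wave \<xi> x))
      (complex_of_real (exp (- (4 * pi\<^sup>2 * (norm \<xi>)\<^sup>2) * t)))"
    using has_bochner_integral_mult_right[OF fourier_integral_gaussian[of "1 / (4 * t)" \<xi>], of "of_real N"] t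
    by (simp only: of_real_mult[symmetric] *) simp
  then show ?thesis
    by (simp add: heat_kernel_def N_def mult_ac)
qed

section \<open>The Schwartz space\<close>

definition partial :: "'a \<Rightarrow> ('a::euclidean_space \<Rightarrow> complex) \<Rightarrow> 'a \<Rightarrow> complex" where
  "partial b f = (\<lambda>x. frechet_derivative f (at x) b)"

text \<open>
  Iterated partial derivatives add new directions on the outside; peeling off the innermost one
  instead makes the Schwartz space visibly stable under differentiation.
\<close>

lemma iter_partial_snoc: "iter_partial (bs @ [b]) f = iter_partial bs (partial b f)"
  by (induction bs) (auto simp: partial_def)

lemma has_derivative_imp_partial: "(\<And>x. (f has_derivative f' x) (at x)) \<Longrightarrow> partial b f = (\<lambda>x. f' x b)"
  unfolding partial_def by (metis frechet_derivative_at)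

lemma schwartz_differentiable: "f \<in> schwartz \<Longrightarrow> f differentiable at x"
  unfolding schwartz_def by (auto dest: spec[of _ "[]"])

lemma schwartz_has_derivative: "f \<in> schwartz \<Longrightarrow> (f has_derivative frechet_derivative f (at x)) (at x)"
  using schwartz_differentiable frechet_derivative_works by blast

lemma bdd_above_range_iff: "bdd_above (range f) \<longleftrightarrow> (\<exists>C. \<forall>x. f x \<le> C)"
  unfolding bdd_above_def by blast

lemma schwartz_bounded: "f \<in> schwartz \<Longrightarrow> bdd_above (range (\<lambda>x. norm x ^ k * cmod (f x)))"
  unfolding schwartz_def by (auto dest: spec[of _ "[]"])

lemma schwartz_partial: "f \<in> schwartz \<Longrightarrow> b \<in> Basis \<Longrightarrow> partial b f \<in> schwartz"
  unfolding schwartz_def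
  by (auto simp flip: iter_partial_snoc)

text \<open>
  The Schwartz space is the largest class of differentiable, rapidly decreasing functions that is
  stable under partial derivatives. Exhibiting some such class that contains \<open>f\<close> therefore proves
  that \<open>f\<close> is a Schwartz function, without computing its higher derivatives.
\<close>

lemma schwartz_coinduct:
  assumes "f \<in> P"
    and diff: "\<And>g x. g \<in> P \<Longrightarrow> g differentiable at x"
    and bdd: "\<And>g k. g \<in> P \<Longrightarrow> bdd_above (range (\<lambda>x. norm x ^ k * cmod (g x)))"
    and partial: "\<And>g b. g \<in> P \<Longrightarrow> b \<in> Basis \<Longrightarrow> partial b g \<in> P"
  shows "f \<in> schwartz"
proof -
  have iter: "iter_partial bs f \<in> P" if "set bs \<subseteq> Basis" for bs
    using that
  proof (induction bs)
    case Nil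
    then show ?case using assms(1) by simp
  next
    case (Cons b bs)
    then have "partial b (iter_partial bs f) \<in> P" by (intro partial) auto
    then show ?case by (simp add: partial_def)
  qed
  then show ?thesis
    unfolding schwartz_def by (intro CollectI allI impI conjI diff bdd)
qed

lemma schwartz_zero: "(\<lambda>x. 0) \<in> schwartz"
proof (rule schwartz_coinduct[where P = "{\<lambda>x. 0}"])
  fix g :: "'a \<Rightarrow> complex" and b :: 'a assume g: "g \<in> {\<lambda>x. 0}"
  have "partial b (\<lambda>x. 0) = (\<lambda>x. 0)"
    by (rule has_derivative_imp_partial) (rule has_derivative_const)
  then show "partial b g \<in> {\<lambda>x. 0}" using g by simp
qed auto

lemma bdd_above_weighted_add:
  assumes "bdd_above (range (\<lambda>x. w x * cmod (g x)))" "bdd_above (range (\<lambda>x. w x * cmod (h x)))"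
    and "\<And>x. 0 \<le> w x"
  shows "bdd_above (range (\<lambda>x. w x * cmod (a * g x + b * h x)))"
proof -
  from assms obtain A B where AB: "\<And>x. w x * cmod (g x) \<le> A" "\<And>x. w x * cmod (h x) \<le> B"
    unfolding bdd_above_range_iff by blast
  have "w x * cmod (a * g x + b * h x) \<le> cmod a * A + cmod b * B" for x
  proof -
    have "w x * cmod (a * g x + b * h x) \<le> w x * (cmod a * cmod (g x) + cmod b * cmod (h x))"
      using assms(3) by (intro mult_left_mono order.trans[OF norm_triangle_ineq]) (auto simp: norm_mult)
    also have "\<dots> = cmod a * (w x * cmod (g x)) + cmod b * (w x * cmod (h x))"
      by (simp add: algebra_simps)
    also have "\<dots> \<le> cmod a * A + cmod b * B"
      by (intro add_mono mult_left_mono AB) auto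
    finally show ?thesis .
  qed
  then show ?thesis unfolding bdd_above_range_iff by blast
qed

lemma schwartz_linear_combination:
  assumes "f \<in> schwartz" "g \<in> schwartz"
  shows "(\<lambda>x. a * f x + b * g x) \<in> schwartz"
proof (rule schwartz_coinduct[where P = "{\<lambda>x. a * f x + b * g x | f g. f \<in> schwartz \<and> g \<in> schwartz}"],
    safe)
  fix g h :: "'a \<Rightarrow> complex" assume gh: "g \<in> schwartz" "h \<in> schwartz"
  have der: "((\<lambda>x. a * g x + b * h x) has_derivative
      (\<lambda>v. a * frechet_derivative g (at x) v + b * frechet_derivative h (at x) v)) (at x)" for x
    by (intro derivative_intros schwartz_has_derivative gh)
  from der show "(\<lambda>x. a * g x + b * h x) differentiable at x" for x
    by (auto simp: differentiable_def)
  show "bdd_above (range (\<lambda>x. norm x ^ k * cmod (a * g x + b * h x)))" for k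
    by (intro bdd_above_weighted_add schwartz_bounded gh) auto
  fix c :: 'a assume c: "c \<in> Basis"
  have "partial c (\<lambda>x. a * g x + b * h x) = (\<lambda>x. a * partial c g x + b * partial c h x)"
    using has_derivative_imp_partial[OF der] by (simp add: partial_def)
  then show "\<exists>p q. partial c (\<lambda>x. a * g x + b * h x) = (\<lambda>x. a * p x + b * q x) \<and> p \<in> schwartz \<and> q \<in> schwartz"
    by (intro exI[of _ "partial c g"] exI[of _ "partial c h"] conjI schwartz_partial gh c)
qed (use assms in auto)

lemma schwartz_scale: "f \<in> schwartz \<Longrightarrow> (\<lambda>x. a * f x) \<in> schwartz"
  using schwartz_linear_combination[of f f a 0] by simp

lemma schwartz_add: "f \<in> schwartz \<Longrightarrow> g \<in> schwartz \<Longrightarrow> (\<lambda>x. f x + g x) \<in> schwartz"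
  using schwartz_linear_combination[of f g 1 1] by simp

lemma schwartz_diff: "f \<in> schwartz \<Longrightarrow> g \<in> schwartz \<Longrightarrow> (\<lambda>x. f x - g x) \<in> schwartz"
  using schwartz_linear_combination[of f g 1 "-1"] by simp

text \<open>
  The products \<open>x\<^sub>b g\<close> are not stable under derivatives, but the sums \<open>x\<^sub>b g + h\<close> are, by the
  Leibniz rule.
\<close>

lemma schwartz_mult_coordinate:
  assumes f: "f \<in> schwartz" and b: "b \<in> Basis"
  shows "(\<lambda>x. of_real (x \<bullet> b) * f x) \<in> schwartz"
proof (rule schwartz_coinduct[where P =
      "{\<lambda>x. of_real (x \<bullet> b) * g x + h x | g h. g \<in> schwartz \<and> h \<in> schwartz}"], safe)
  fix g h :: "'a \<Rightarrow> complex" assume gh: "g \<in> schwartz" "h \<in> schwartz"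
  have der: "((\<lambda>x. of_real (x \<bullet> b) * g x + h x) has_derivative
      (\<lambda>v. of_real (x \<bullet> b) * frechet_derivative g (at x) v + of_real (v \<bullet> b) * g x
         + frechet_derivative h (at x) v)) (at x)" for x
    by (auto intro!: derivative_eq_intros schwartz_has_derivative gh)
  from der show "(\<lambda>x. of_real (x \<bullet> b) * g x + h x) differentiable at x" for x
    by (auto simp: differentiable_def)
  show "bdd_above (range (\<lambda>x. norm x ^ k * cmod (of_real (x \<bullet> b) * g x + h x)))" for k
  proof -
    obtain A where A: "\<And>x. norm x ^ Suc k * cmod (g x) \<le> A"
      using schwartz_bounded[OF gh(1), of "Suc k"] unfolding bdd_above_range_iff by blast
    have "norm x ^ k * cmod (of_real (x \<bullet> b) * g x) \<le> A" for x
    proof -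
      have "norm x ^ k * cmod (of_real (x \<bullet> b) * g x) \<le> norm x ^ k * (norm x * cmod (g x))"
        using b by (auto intro!: mult_mono simp: norm_mult Basis_le_norm)
      also have "\<dots> \<le> A" using A[of x] by (simp add: mult_ac)
      finally show ?thesis .
    qed
    then have "bdd_above (range (\<lambda>x. norm x ^ k * cmod (of_real (x \<bullet> b) * g x)))"
      unfolding bdd_above_range_iff by blast
    from bdd_above_weighted_add[OF this schwartz_bounded[OF gh(2)], of 1 1]
    show ?thesis by simp
  qed
  fix c :: 'a assume c: "c \<in> Basis"
  have "partial c (\<lambda>x. of_real (x \<bullet> b) * g x + h x)
      = (\<lambda>x. of_real (x \<bullet> b) * partial c g x + (of_real (c \<bullet> b) * g x + partial c h x))"
    using has_derivative_imp_partial[OF der] by (simp add: partial_def add.assoc)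
  moreover have "(\<lambda>x. of_real (c \<bullet> b) * g x + partial c h x) \<in> schwartz"
    by (intro schwartz_add schwartz_scale schwartz_partial gh c)
  ultimately show "\<exists>p q. partial c (\<lambda>x. of_real (x \<bullet> b) * g x + h x) = (\<lambda>x. of_real (x \<bullet> b) * p x + q x)
      \<and> p \<in> schwartz \<and> q \<in> schwartz"
    using schwartz_partial[OF gh(1) c]
    by (intro exI[of _ "partial c g"] exI[of _ "\<lambda>x. of_real (c \<bullet> b) * g x + partial c h x"] conjI)
next
  show "\<exists>g h. (\<lambda>x. of_real (x \<bullet> b) * f x) = (\<lambda>x. of_real (x \<bullet> b) * g x + h x) \<and> g \<in> schwartz \<and> h \<in> schwartz"
    using f schwartz_zero by (intro exI[of _ f] exI[of _ "\<lambda>x. 0"]) simp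
qed

text \<open>
  An integrable majorant for Schwartz functions. The power \<open>DIM('a)\<close> makes it bounded by the
  product of the functions \<open>1 / (1 + x\<^sub>b\<^sup>2)\<close> of the single coordinates, whose integral factorises.
\<close>

definition decay :: "'a::euclidean_space \<Rightarrow> real" where
  "decay x = inverse ((1 + (norm x)\<^sup>2) ^ DIM('a))"

lemma decay_pos: "decay x > 0"
  by (auto simp: decay_def add_pos_nonneg)

lemma continuous_decay [continuous_intros]: "continuous_on S f \<Longrightarrow> continuous_on S (\<lambda>x. decay (f x))"
  unfolding decay_def by (intro continuous_intros) (auto simp: add_nonneg_eq_0_iff)

lemma measurable_decay [measurable]: "decay \<in> borel_measurable borel"
  by (intro borel_measurable_continuous_onI continuous_intros)

lemma integrable_decay: "integrable lborel (decay :: 'a::euclidean_space \<Rightarrow> real)"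
proof -
  have 1: "integrable lborel (\<lambda>x::real. inverse (1 + x\<^sup>2))"
    using integrable_inverse_1_plus_square by (simp add: set_integrable_def)
  have *: "integrable lborel (\<lambda>x::'a. \<Prod>b\<in>Basis. inverse (1 + (x \<bullet> b)\<^sup>2))"
    using has_bochner_integral_lborel_prod[OF has_bochner_integral_integrable[OF 1]]
    by (auto simp: has_bochner_integral_iff)
  have "decay x \<le> (\<Prod>b\<in>Basis. inverse (1 + (x \<bullet> b)\<^sup>2))" for x :: 'a
  proof -
    have "decay x = (\<Prod>b\<in>(Basis::'a set). inverse (1 + (norm x)\<^sup>2))"
      by (simp add: decay_def power_inverse)
    also have "\<dots> \<le> (\<Prod>b\<in>Basis. inverse (1 + (x \<bullet> b)\<^sup>2))"
    proof (intro prod_mono conjI)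
      fix b :: 'a assume "b \<in> Basis"
      then have "(x \<bullet> b)\<^sup>2 \<le> (norm x)\<^sup>2"
        by (metis Basis_le_norm abs_le_square_iff abs_norm_cancel)
      then show "inverse (1 + (norm x)\<^sup>2) \<le> inverse (1 + (x \<bullet> b)\<^sup>2)"
        by (intro le_imp_inverse_le) (auto simp: add_pos_nonneg)
    qed auto
    finally show ?thesis .
  qed
  then have "norm (decay x) \<le> norm (\<Prod>b\<in>Basis. inverse (1 + (x \<bullet> b)\<^sup>2))" for x :: 'a
    using decay_pos[of x] by (metis abs_ge_self abs_of_pos order_trans real_norm_def)
  then show ?thesis
    by (intro Bochner_Integration.integrable_bound[OF *]) auto
qed

text \<open>
  The bounds for the weights \<open>norm x ^ k\<close> and \<open>norm x ^ (k + 2 * n)\<close> are combined, since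
  \<open>(1 + r\<^sup>2) ^ n \<le> 2 ^ n * (1 + r ^ (2 * n))\<close>.
\<close>

lemma schwartz_decay:
  assumes f: "f \<in> schwartz"
  obtains C where "C \<ge> 0" "\<And>x::'a::euclidean_space. norm x ^ k * cmod (f x) \<le> C * decay x"
proof -
  let ?n = "DIM('a)"
  obtain A B where A: "\<And>x. norm x ^ k * cmod (f x) \<le> A"
    and B: "\<And>x. norm x ^ (k + 2 * ?n) * cmod (f x) \<le> B"
    using schwartz_bounded[OF f, of k] schwartz_bounded[OF f, of "k + 2 * ?n"]
    unfolding bdd_above_range_iff by blast
  have "norm x ^ k * cmod (f x) \<le> 2 ^ ?n * (A + B) * decay x" for x
  proof -
    have "(1 + (norm x)\<^sup>2) ^ ?n \<le> (2 * max 1 ((norm x)\<^sup>2)) ^ ?n"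
      by (intro power_mono) auto
    also have "\<dots> \<le> 2 ^ ?n * (1 + norm x ^ (2 * ?n))"
      by (cases "(norm x)\<^sup>2 \<le> 1") (auto simp: power_mult_distrib max_def power_mult)
    finally have "(1 + (norm x)\<^sup>2) ^ ?n * (norm x ^ k * cmod (f x))
        \<le> 2 ^ ?n * (1 + norm x ^ (2 * ?n)) * (norm x ^ k * cmod (f x))"
      by (rule mult_right_mono) auto
    also have "\<dots> = 2 ^ ?n * (norm x ^ k * cmod (f x) + norm x ^ (k + 2 * ?n) * cmod (f x))"
      by (simp only: mult_1 distrib_right distrib_left mult.assoc mult.left_commute power_add)
    also have "\<dots> \<le> 2 ^ ?n * (A + B)"
      by (intro mult_left_mono add_mono A B) simp
    finally have "(1 + (norm x)\<^sup>2) ^ ?n * (norm x ^ k * cmod (f x)) \<le> 2 ^ ?n * (A + B)" .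
    moreover have "(1 + (norm x)\<^sup>2) ^ ?n > 0"
      by (intro zero_less_power add_pos_nonneg) auto
    ultimately show ?thesis
      unfolding decay_def divide_inverse[symmetric] by (simp only: pos_le_divide_eq mult.commute)
  qed
  moreover have "0 \<le> A" by (rule order_trans[OF _ A[of 0]]) simp
  moreover have "0 \<le> B" by (rule order_trans[OF _ B[of 0]]) simp
  ultimately show ?thesis by (intro that[of "2 ^ ?n * (A + B)"]) auto
qed

lemma schwartz_continuous: "f \<in> schwartz \<Longrightarrow> continuous_on S f"
  using schwartz_differentiable
  by (meson continuous_at_imp_continuous_on differentiable_imp_continuous_within)

lemma schwartz_measurable: "f \<in> schwartz \<Longrightarrow> f \<in> borel_measurable borel"
  by (intro borel_measurable_continuous_onI schwartz_continuous)

lemma schwartz_integrable_weighted: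
  fixes f :: "'a::euclidean_space \<Rightarrow> complex"
  assumes f: "f \<in> schwartz"
  shows "integrable lborel (\<lambda>x. norm x ^ k * cmod (f x))"
proof -
  obtain C where C: "C \<ge> 0" "\<And>x. norm x ^ k * cmod (f x) \<le> C * decay x"
    using schwartz_decay[OF f] by blast
  have *: "integrable lborel (\<lambda>x::'a. C * decay x)"
    by (intro integrable_mult_right integrable_decay)
  have [measurable]: "f \<in> borel_measurable borel" by (rule schwartz_measurable[OF f])
  show ?thesis
    by (rule Bochner_Integration.integrable_bound[OF *])
      (use C in \<open>auto intro!: AE_I2 intro: order_trans[OF _ abs_ge_self]\<close>)
qed

lemma schwartz_integrable: "f \<in> schwartz \<Longrightarrow> integrable lborel f"
  using schwartz_integrable_weighted[of f 0] schwartz_measurable[of f]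
  by (simp add: integrable_norm_iff)

section \<open>The Fourier transform preserves the Schwartz space\<close>

lemma integrable_mult_wave:
  "integrable lborel f \<Longrightarrow> integrable lborel (\<lambda>x. f x * wave \<xi> x)"
  by (rule Bochner_Integration.integrable_bound[of _ f]) (auto simp: norm_mult wave_def)

lemma norm_fourier_transform_le: "cmod (fourier_transform f \<xi>) \<le> (LINT x|lborel. cmod (f x))"
  unfolding fourier_transform_wave
  by (rule order_trans[OF integral_norm_bound]) (simp add: norm_mult)

lemma wave_linear_remainder:
  "cmod (wave h x - 1 + 2 * of_real pi * \<i> * of_real (x \<bullet> h)) \<le> 2 * pi\<^sup>2 * (norm x)\<^sup>2 * (norm h)\<^sup>2"
proof -
  define u where "u = - (2 * pi * (x \<bullet> h))"
  have "cmod (iexp u - (\<Sum>k\<le>1. (\<i> * of_real u) ^ k / fact k)) \<le> \<bar>u\<bar> ^ Suc 1 / fact (Suc 1)"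
    by (rule iexp_approx1)
  also have "(\<Sum>k\<le>1. (\<i> * of_real u) ^ k / fact k) = 1 + \<i> * of_real u"
    by simp
  also have "\<bar>u\<bar> ^ Suc 1 / fact (Suc 1) = 2 * pi\<^sup>2 * (x \<bullet> h)\<^sup>2"
    by (simp add: u_def power_mult_distrib flip: power2_eq_square)
  also have "\<dots> \<le> 2 * pi\<^sup>2 * (norm x * norm h)\<^sup>2"
    by (intro mult_left_mono power2_le_iff_abs_le[THEN iffD2] Cauchy_Schwarz_ineq2) auto
  also have "iexp u - (1 + \<i> * of_real u) = wave h x - 1 + 2 * of_real pi * \<i> * of_real (x \<bullet> h)"
    unfolding wave_iexp u_def by (simp add: algebra_simps)
  finally show ?thesis by (simp add: power_mult_distrib mult_ac)
qed

text \<open>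
  Differentiation under the integral sign. The second order Taylor remainder of the character
  contributes at most a multiple of \<open>(norm h)\<^sup>2\<close>, because \<open>(norm x)\<^sup>2 * cmod (f x)\<close> is integrable.
\<close>

lemma fourier_transform_has_derivative:
  fixes f :: "'a::euclidean_space \<Rightarrow> complex"
  assumes f: "f \<in> schwartz"
  shows "(fourier_transform f has_derivative
           (\<lambda>h. LINT x|lborel. - (2 * of_real pi * \<i> * of_real (x \<bullet> h)) * (f x * wave \<xi> x))) (at \<xi>)"
    (is "(_ has_derivative (\<lambda>h. integral\<^sup>L lborel (?D h))) _")
proof (rule has_derivativeI_sandwich[of 1])
  have [measurable]: "f \<in> borel_measurable borel" by (rule schwartz_measurable[OF f])
  have int_f: "integrable lborel (\<lambda>x. f x * wave \<xi> x)" for \<xi>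
    by (intro integrable_mult_wave schwartz_integrable f)
  have int_D: "integrable lborel (?D h)" for h
  proof (rule Bochner_Integration.integrable_bound)
    show "integrable lborel (\<lambda>x. 2 * pi * norm h * (norm x ^ 1 * cmod (f x)))"
      by (intro integrable_mult_right schwartz_integrable_weighted f)
    have "2 * pi * \<bar>x \<bullet> h\<bar> * cmod (f x) \<le> 2 * pi * norm h * (norm x * cmod (f x))" for x
      using mult_right_mono[OF Cauchy_Schwarz_ineq2[of x h], of "2 * pi * cmod (f x)"]
      by (simp add: mult_ac)
    then show "AE x in lborel. norm (?D h x) \<le> norm (2 * pi * norm h * (norm x ^ 1 * cmod (f x)))"
      by (auto simp: norm_mult abs_mult mult_ac)
  qed simp
  have "linear (\<lambda>h. integral\<^sup>L lborel (?D h))"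
  proof (rule linearI)
    fix h k :: 'a and r :: real
    have "?D (h + k) = (\<lambda>x. ?D h x + ?D k x)"
      by (auto simp: inner_add_right algebra_simps)
    then show "integral\<^sup>L lborel (?D (h + k)) = integral\<^sup>L lborel (?D h) + integral\<^sup>L lborel (?D k)"
      by (simp only: Bochner_Integration.integral_add[OF int_D int_D])
    have "?D (r *\<^sub>R h) = (\<lambda>x. r *\<^sub>R ?D h x)"
      by (auto simp: scaleR_conv_of_real mult_ac)
    then show "integral\<^sup>L lborel (?D (r *\<^sub>R h)) = r *\<^sub>R integral\<^sup>L lborel (?D h)"
      by (simp only: integral_scaleR_right)
  qed
  then show "bounded_linear (\<lambda>h. integral\<^sup>L lborel (?D h))"
    by (simp add: linear_conv_bounded_linear)
  define C where "C = 2 * pi\<^sup>2 * (LINT x|lborel. norm x ^ 2 * cmod (f x))"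
  have int2: "integrable lborel (\<lambda>x. 2 * pi\<^sup>2 * (norm h)\<^sup>2 * (norm x ^ 2 * cmod (f x)))" for h :: 'a
    by (intro integrable_mult_right schwartz_integrable_weighted f)
  show "norm (fourier_transform f \<eta> - fourier_transform f \<xi> - integral\<^sup>L lborel (?D (\<eta> - \<xi>))) / norm (\<eta> - \<xi>)
      \<le> C * norm (\<eta> - \<xi>)" if "\<eta> \<noteq> \<xi>" for \<eta>
  proof -
    define h where "h = \<eta> - \<xi>"
    have \<eta>: "wave \<eta> x = wave \<xi> x * wave h x" for x
      using wave_add[of x \<xi> h] by (simp add: h_def wave_commute)
    have "fourier_transform f \<eta> - fourier_transform f \<xi> - integral\<^sup>L lborel (?D h)
        = (LINT x|lborel. f x * wave \<eta> x - f x * wave \<xi> x - ?D h x)"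
      unfolding fourier_transform_wave
      by (simp only: Bochner_Integration.integral_diff Bochner_Integration.integrable_diff int_f int_D)
    also have "norm \<dots> \<le> (LINT x|lborel. 2 * pi\<^sup>2 * (norm h)\<^sup>2 * (norm x ^ 2 * cmod (f x)))"
    proof (rule order_trans[OF integral_norm_bound], rule integral_mono)
      show "integrable lborel (\<lambda>x. norm (f x * wave \<eta> x - f x * wave \<xi> x - ?D h x))"
        by (intro integrable_norm Bochner_Integration.integrable_diff int_f int_D)
      fix x :: 'a
      have "f x * wave \<eta> x - f x * wave \<xi> x - ?D h x
          = (f x * wave \<xi> x) * (wave h x - 1 + 2 * of_real pi * \<i> * of_real (x \<bullet> h))"
        unfolding \<eta> by (simp add: algebra_simps)
      then have "norm (f x * wave \<eta> x - f x * wave \<xi> x - ?D h x)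
          = cmod (f x) * cmod (wave h x - 1 + 2 * of_real pi * \<i> * of_real (x \<bullet> h))"
        by (simp only: norm_mult norm_wave mult_1_right)
      also have "\<dots> \<le> cmod (f x) * (2 * pi\<^sup>2 * (norm x)\<^sup>2 * (norm h)\<^sup>2)"
        by (intro mult_left_mono wave_linear_remainder) simp
      finally show "norm (f x * wave \<eta> x - f x * wave \<xi> x - ?D h x)
          \<le> 2 * pi\<^sup>2 * (norm h)\<^sup>2 * (norm x ^ 2 * cmod (f x))" by (simp only: mult_ac)
    qed (rule int2)
    also have "\<dots> = C * (norm h)\<^sup>2" by (simp add: C_def)
    finally show ?thesis using that by (simp add: h_def divide_le_eq power2_eq_square mult_ac)
  qed
  show "((\<lambda>\<eta>. C * norm (\<eta> - \<xi>)) \<longlongrightarrow> 0) (at \<xi>)"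
    by (auto intro!: tendsto_eq_intros)
qed auto

text \<open>
  A sequential form of differentiability, suited to dominated convergence.
\<close>

lemma difference_quotient_LIMSEQ:
  fixes \<phi> :: "real \<Rightarrow> complex"
  assumes "(\<phi> has_vector_derivative D) (at 0)"
  shows "(\<lambda>n. of_nat (Suc n) * (\<phi> (inverse (of_nat (Suc n))) - \<phi> 0)) \<longlonglongrightarrow> D"
proof -
  have "((\<lambda>h. norm (\<phi> h - \<phi> 0 - h *\<^sub>R D) / norm h) \<longlongrightarrow> 0) (at 0)"
    using assms unfolding has_vector_derivative_def has_derivative_iff_norm by simp
  moreover have "filterlim (\<lambda>n. inverse (real (Suc n))) (at 0) sequentially"
    unfolding filterlim_at using LIMSEQ_inverse_real_of_nat by auto
  ultimately have "(\<lambda>n. norm (\<phi> (inverse (real (Suc n))) - \<phi> 0 - inverse (real (Suc n)) *\<^sub>R D)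
      / norm (inverse (real (Suc n)))) \<longlonglongrightarrow> 0"
    by (rule filterlim_compose)
  also have "(\<lambda>n. norm (\<phi> (inverse (real (Suc n))) - \<phi> 0 - inverse (real (Suc n)) *\<^sub>R D)
      / norm (inverse (real (Suc n))))
      = (\<lambda>n. norm (of_nat (Suc n) * (\<phi> (inverse (of_nat (Suc n))) - \<phi> 0) - D))"
  proof
    fix n
    let ?N = "real (Suc n)"
    have "of_nat (Suc n) * (\<phi> (inverse ?N) - \<phi> 0) - D
        = ?N *\<^sub>R (\<phi> (inverse ?N) - \<phi> 0 - inverse ?N *\<^sub>R D)"
      by (simp only: scaleR_diff_right scaleR_scaleR right_inverse of_nat_eq_0_iff nat.distinct
          not_False_eq_True scaleR_one) (simp only: scaleR_conv_of_real of_real_of_nat_eq right_diff_distrib)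
    then show "norm (\<phi> (inverse ?N) - \<phi> 0 - inverse ?N *\<^sub>R D) / norm (inverse ?N)
      = norm (of_nat (Suc n) * (\<phi> (inverse (of_nat (Suc n))) - \<phi> 0) - D)"
      by (simp only: norm_scaleR) (simp add: divide_inverse mult.commute)
  qed
  finally show ?thesis
    by (intro LIM_zero_cancel[of _ D]) (rule tendsto_norm_zero_cancel)
qed

lemma schwartz_line_derivative:
  assumes f: "f \<in> schwartz"
  shows "((\<lambda>s. f (x + s *\<^sub>R b)) has_vector_derivative partial b f (x + s *\<^sub>R b)) (at s)"
proof -
  have lin: "linear (frechet_derivative f (at y))" for y
    using schwartz_has_derivative[OF f] has_derivative_linear by blast
  have "((\<lambda>s. f (x + s *\<^sub>R b)) has_derivative (\<lambda>h. frechet_derivative f (at (x + s *\<^sub>R b)) (h *\<^sub>R b))) (at s)"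
    by (rule has_derivative_compose[OF _ schwartz_has_derivative[OF f]])
      (auto intro!: derivative_eq_intros)
  then show ?thesis
    by (simp add: has_vector_derivative_def partial_def linear_cmul[OF lin])
qed

lemma decay_shift:
  fixes x v :: "'a::euclidean_space"
  assumes "norm v \<le> 1"
  shows "decay (x + v) \<le> 3 ^ DIM('a) * decay x"
proof -
  have "norm x \<le> norm (x + v) + 1"
    using norm_triangle_ineq4[of "x + v" v] assms by simp
  then have "(norm x)\<^sup>2 \<le> (norm (x + v) + 1)\<^sup>2" by (intro power_mono) auto
  also have "\<dots> \<le> 2 * (norm (x + v))\<^sup>2 + 2"
    using zero_le_power2[of "norm (x + v) - 1"] by (simp add: power2_eq_square algebra_simps)
  finally have "1 + (norm x)\<^sup>2 \<le> 3 * (1 + (norm (x + v))\<^sup>2)"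
    by (rule order_trans[OF add_left_mono]) simp
  then have "(1 + (norm x)\<^sup>2) ^ DIM('a) \<le> (3 * (1 + (norm (x + v))\<^sup>2)) ^ DIM('a)"
    by (intro power_mono) auto
  then have "inverse (decay x) \<le> 3 ^ DIM('a) * inverse (decay (x + v))"
    by (simp only: decay_def inverse_inverse_eq power_mult_distrib)
  then show ?thesis
    using decay_pos[of x] decay_pos[of "x + v"] by (simp add: field_simps)
qed

text \<open>
  The mean value inequality along \<open>b\<close>. It dominates the difference quotients of \<open>f\<close> by one
  integrable function.
\<close>

lemma schwartz_increment_bound:
  fixes f :: "'a::euclidean_space \<Rightarrow> complex"
  assumes f: "f \<in> schwartz" and b: "b \<in> Basis"
  obtains C where "C \<ge> 0" "\<And>x s. 0 \<le> s \<Longrightarrow> s \<le> 1 \<Longrightarrow> cmod (f (x + s *\<^sub>R b) - f x) \<le> C * decay x * s"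
proof -
  obtain C where C: "C \<ge> 0" "\<And>x. norm x ^ 0 * cmod (partial b f x) \<le> C * decay x"
    using schwartz_decay[OF schwartz_partial[OF f b]] by blast
  have bound: "cmod (partial b f (x + s *\<^sub>R b)) \<le> C * (3 ^ DIM('a) * decay x)" if "\<bar>s\<bar> \<le> 1" for x s
  proof -
    have "norm (s *\<^sub>R b) \<le> 1" using that b by simp
    from mult_left_mono[OF decay_shift[OF this] C(1), of x] C(2)[of "x + s *\<^sub>R b"]
    show ?thesis by simp
  qed
  have "cmod (f (x + s *\<^sub>R b) - f x) \<le> C * 3 ^ DIM('a) * decay x * s" if s: "0 \<le> s" "s \<le> 1" for x s
  proof -
    have "norm (f (x + s *\<^sub>R b) - f (x + 0 *\<^sub>R b)) \<le> C * (3 ^ DIM('a) * decay x) * norm (s - 0)"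
    proof (rule differentiable_bound[of "{0..1}"])
      fix r :: real assume r: "r \<in> {0..1}"
      show "((\<lambda>s. f (x + s *\<^sub>R b)) has_derivative (\<lambda>h. h *\<^sub>R partial b f (x + r *\<^sub>R b))) (at r within {0..1})"
        using schwartz_line_derivative[OF f, of x b r]
        by (auto simp: has_vector_derivative_def intro: has_derivative_at_withinI)
      show "onorm (\<lambda>h. h *\<^sub>R partial b f (x + r *\<^sub>R b)) \<le> C * (3 ^ DIM('a) * decay x)"
      proof (rule onorm_bound)
        show "0 \<le> C * (3 ^ DIM('a) * decay x)" by (intro mult_nonneg_nonneg C(1) less_imp_le[OF decay_pos]) simp
        show "norm (h *\<^sub>R partial b f (x + r *\<^sub>R b)) \<le> C * (3 ^ DIM('a) * decay x) * norm h" for h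
          using mult_right_mono[OF bound[of r x], of "\<bar>h\<bar>"] r by (simp add: mult.commute)
      qed
    qed (use s in auto)
    then show ?thesis using s by simp
  qed
  then show ?thesis using C(1) by (intro that[of "C * 3 ^ DIM('a)"]) auto
qed

text \<open>
  Integration by parts in disguise: translating \<open>f\<close> by \<open>t b\<close> multiplies its transform by a
  character, hence the transform of a difference quotient of \<open>f\<close> is the transform of \<open>f\<close> times a
  difference quotient of \<open>t \<mapsto> exp (2 \<pi> i (\<xi> \<cdot> b) t)\<close>; then \<open>t\<close> tends to \<open>0\<close>.
\<close>

lemma fourier_transform_partial:
  fixes f :: "'a::euclidean_space \<Rightarrow> complex"
  assumes f: "f \<in> schwartz" and b: "b \<in> Basis"
  shows "fourier_transform (partial b f) \<xi> = 2 * of_real pi * \<i> * of_real (\<xi> \<bullet> b) * fourier_transform f \<xi>"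
proof -
  define t where "t n = inverse (real (Suc n))" for n
  have t: "0 \<le> t n" "t n \<le> 1" "real (Suc n) * t n = 1" for n
    by (auto simp: t_def inverse_le_1_iff)
  have [measurable]: "f \<in> borel_measurable borel" "partial b f \<in> borel_measurable borel"
    by (intro schwartz_measurable schwartz_partial f b)+
  obtain C where C: "C \<ge> 0" "\<And>x s. 0 \<le> s \<Longrightarrow> s \<le> 1 \<Longrightarrow> cmod (f (x + s *\<^sub>R b) - f x) \<le> C * decay x * s"
    using schwartz_increment_bound[OF f b] by blast
  define q where "q n x = of_nat (Suc n) * (f (x + t n *\<^sub>R b) - f x) * wave \<xi> x" for n x
  have lim1: "(\<lambda>n. LINT x|lborel. q n x) \<longlonglongrightarrow> (LINT x|lborel. partial b f x * wave \<xi> x)"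
  proof (rule integral_dominated_convergence)
    show "integrable lborel (\<lambda>x::'a. C * decay x)"
      by (intro integrable_mult_right integrable_decay)
    show "AE x in lborel. (\<lambda>n. q n x) \<longlonglongrightarrow> partial b f x * wave \<xi> x"
    proof (rule AE_I2)
      fix x
      show "(\<lambda>n. q n x) \<longlonglongrightarrow> partial b f x * wave \<xi> x"
        unfolding q_def t_def
        by (rule tendsto_mult_right)
          (use difference_quotient_LIMSEQ[OF schwartz_line_derivative[OF f, of x b 0]] in simp)
    qed
    show "AE x in lborel. norm (q n x) \<le> C * decay x" for n
    proof (rule AE_I2)
      fix x
      have "norm (q n x) = real (Suc n) * cmod (f (x + t n *\<^sub>R b) - f x)"
        by (simp add: q_def norm_mult del: of_nat_Suc)
      also have "\<dots> \<le> real (Suc n) * (C * decay x * t n)"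
        by (intro mult_left_mono C t) simp
      also have "\<dots> = C * decay x" using t(3)[of n] by (metis mult.left_commute mult_1_right)
      finally show "norm (q n x) \<le> C * decay x" .
    qed
  qed (auto simp: q_def)
  have int_f: "has_bochner_integral lborel (\<lambda>x. f x * wave \<xi> x) (fourier_transform f \<xi>)"
    unfolding fourier_transform_wave
    by (intro has_bochner_integral_integrable integrable_mult_wave schwartz_integrable f)
  have "(LINT x|lborel. q n x)
      = of_nat (Suc n) * (iexp (2 * pi * (\<xi> \<bullet> b) * t n) - iexp (2 * pi * (\<xi> \<bullet> b) * 0)) * fourier_transform f \<xi>" for n
  proof -
    have "has_bochner_integral lborel (\<lambda>x. f (t n *\<^sub>R b + 1 *\<^sub>R x) * wave \<xi> (t n *\<^sub>R b + 1 *\<^sub>R x)) (fourier_transform f \<xi>)"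
      using has_bochner_integral_lborel_affine[OF _ int_f, of 1 "t n *\<^sub>R b"] by simp
    then have "has_bochner_integral lborel
       (\<lambda>x. of_nat (Suc n) * (wave \<xi> (- (t n *\<^sub>R b)) * (f (t n *\<^sub>R b + 1 *\<^sub>R x) * wave \<xi> (t n *\<^sub>R b + 1 *\<^sub>R x)) - f x * wave \<xi> x))
       (of_nat (Suc n) * (wave \<xi> (- (t n *\<^sub>R b)) * fourier_transform f \<xi> - fourier_transform f \<xi>))"
      by (intro has_bochner_integral_mult_right has_bochner_integral_diff int_f) auto
    also have "(\<lambda>x. of_nat (Suc n) * (wave \<xi> (- (t n *\<^sub>R b)) * (f (t n *\<^sub>R b + 1 *\<^sub>R x) * wave \<xi> (t n *\<^sub>R b + 1 *\<^sub>R x)) - f x * wave \<xi> x)) = q n"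
    proof
      fix x
      have "wave \<xi> (- (t n *\<^sub>R b)) * wave \<xi> (t n *\<^sub>R b + 1 *\<^sub>R x) = wave \<xi> x"
        by (simp flip: wave_add)
      then have "wave \<xi> (- (t n *\<^sub>R b)) * (f (t n *\<^sub>R b + 1 *\<^sub>R x) * wave \<xi> (t n *\<^sub>R b + 1 *\<^sub>R x))
          = f (x + t n *\<^sub>R b) * wave \<xi> x"
        by (metis add.commute mult.left_commute scaleR_one)
      then show "of_nat (Suc n) * (wave \<xi> (- (t n *\<^sub>R b)) * (f (t n *\<^sub>R b + 1 *\<^sub>R x) * wave \<xi> (t n *\<^sub>R b + 1 *\<^sub>R x)) - f x * wave \<xi> x) = q n x"
        unfolding q_def by (simp only: left_diff_distrib mult.assoc)
    qed
    finally show ?thesis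
      by (simp add: has_bochner_integral_iff wave_iexp inner_commute algebra_simps)
  qed
  moreover have "(\<lambda>n. of_nat (Suc n) * (iexp (2 * pi * (\<xi> \<bullet> b) * t n) - iexp (2 * pi * (\<xi> \<bullet> b) * 0))
      * fourier_transform f \<xi>) \<longlonglongrightarrow> 2 * of_real pi * \<i> * of_real (\<xi> \<bullet> b) * fourier_transform f \<xi>"
    unfolding t_def
  proof (intro tendsto_mult_right difference_quotient_LIMSEQ[where \<phi> = "\<lambda>s. iexp (2 * pi * (\<xi> \<bullet> b) * s)"])
    show "((\<lambda>s. iexp (2 * pi * (\<xi> \<bullet> b) * s)) has_vector_derivative 2 * of_real pi * \<i> * of_real (\<xi> \<bullet> b)) (at 0)"
      unfolding of_real_mult[of "2 * pi * (\<xi> \<bullet> b)"]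
      by (rule has_vector_derivative_real_field[where f = "\<lambda>z. exp (\<i> * (of_real (2 * pi * (\<xi> \<bullet> b)) * z))"])
        (auto intro!: derivative_eq_intros)
  qed
  ultimately show ?thesis
    using LIMSEQ_unique[OF lim1] by (simp add: fourier_transform_wave)
qed

text \<open>
  Every factor \<open>\<xi> \<bullet> b\<close> can be traded for a derivative of \<open>f\<close>, and the norm is at most the sum of
  the \<open>\<bar>\<xi> \<bullet> b\<bar>\<close>.
\<close>

lemma fourier_transform_weighted_bounded:
  fixes f :: "'a::euclidean_space \<Rightarrow> complex"
  assumes "f \<in> schwartz"
  shows "\<exists>C. \<forall>\<xi>. norm \<xi> ^ k * cmod (fourier_transform f \<xi>) \<le> C"
  using assms
proof (induction k arbitrary: f)
  case 0
  then show ?case using norm_fourier_transform_le by auto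
next
  case (Suc k)
  have "\<exists>C. \<forall>\<xi>. norm \<xi> ^ k * cmod (fourier_transform (partial b f) \<xi>) \<le> C" if "b \<in> Basis" for b
    using Suc that schwartz_partial by blast
  then obtain C where C: "\<And>b \<xi>. b \<in> Basis \<Longrightarrow> norm \<xi> ^ k * cmod (fourier_transform (partial b f) \<xi>) \<le> C b"
    by metis
  have "norm \<xi> ^ Suc k * cmod (fourier_transform f \<xi>) \<le> (\<Sum>b\<in>Basis. C b / (2 * pi))" for \<xi>
  proof -
    have "norm \<xi> ^ Suc k * cmod (fourier_transform f \<xi>)
        \<le> (\<Sum>b\<in>Basis. \<bar>\<xi> \<bullet> b\<bar>) * (norm \<xi> ^ k * cmod (fourier_transform f \<xi>))"
      using mult_right_mono[OF norm_le_l1[of \<xi>], of "norm \<xi> ^ k * cmod (fourier_transform f \<xi>)"]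
      by (simp add: mult_ac)
    also have "\<dots> = (\<Sum>b\<in>Basis. norm \<xi> ^ k * cmod (fourier_transform (partial b f) \<xi>) / (2 * pi))"
      unfolding sum_distrib_right
      by (intro sum.cong refl) (simp add: fourier_transform_partial[OF Suc.prems] norm_mult)
    also have "\<dots> \<le> (\<Sum>b\<in>Basis. C b / (2 * pi))"
      by (intro sum_mono divide_right_mono C) auto
    finally show ?thesis .
  qed
  then show ?case by blast
qed

text \<open>
  Coinduction with the class of all transforms of Schwartz functions: a derivative of a transform
  is the transform of \<open>f\<close> times a coordinate.
\<close>

theorem schwartz_fourier_transform:
  fixes f :: "'a::euclidean_space \<Rightarrow> complex"
  assumes f: "f \<in> schwartz"
  shows "fourier_transform f \<in> schwartz"
proof (rule schwartz_coinduct[where P = "fourier_transform ` schwartz"], safe)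
  fix g :: "'a \<Rightarrow> complex" assume g: "g \<in> schwartz"
  note der = fourier_transform_has_derivative[OF g]
  from der show "fourier_transform g differentiable at x" for x
    by (auto simp: differentiable_def)
  show "bdd_above (range (\<lambda>x. norm x ^ k * cmod (fourier_transform g x)))" for k
    unfolding bdd_above_range_iff by (rule fourier_transform_weighted_bounded[OF g])
  fix b :: 'a assume b: "b \<in> Basis"
  have eq: "partial b (fourier_transform g)
      = fourier_transform (\<lambda>x. - (2 * of_real pi * \<i>) * (of_real (x \<bullet> b) * g x))"
    unfolding has_derivative_imp_partial[OF der]
    by (rule ext, subst fourier_transform_wave, rule Bochner_Integration.integral_cong)
      (simp_all only: mult_minus_left mult_minus_right mult_ac)
  show "partial b (fourier_transform g) \<in> fourier_transform ` schwartz"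
    unfolding eq by (intro imageI schwartz_scale schwartz_mult_coordinate g b)
qed (use f in auto)

section \<open>Fourier inversion\<close>

lemma fourier_transform_multiplication:
  fixes f h :: "'a::euclidean_space \<Rightarrow> complex"
  assumes f: "integrable lborel f" and h: "integrable lborel h"
  shows "(LINT \<xi>|lborel. fourier_transform f \<xi> * h \<xi>) = (LINT x|lborel. f x * fourier_transform h x)"
proof -
  have [measurable]: "f \<in> borel_measurable borel" "h \<in> borel_measurable borel"
    using f h by auto
  have "integrable (lborel \<Otimes>\<^sub>M lborel) (\<lambda>(x, \<xi>). f x * wave \<xi> x * h \<xi>)"
  proof (rule lborel_pair.Fubini_integrable)
    show "(\<lambda>(x, \<xi>). f x * wave \<xi> x * h \<xi>) \<in> borel_measurable (lborel \<Otimes>\<^sub>M lborel)"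
      unfolding wave_def by measurable
    show "integrable lborel (\<lambda>x. LINT \<xi>|lborel. norm (case (x, \<xi>) of (x, \<xi>) \<Rightarrow> f x * wave \<xi> x * h \<xi>))"
      using f h by (simp add: norm_mult)
    show "AE x in lborel. integrable lborel (\<lambda>\<xi>. case (x, \<xi>) of (x, \<xi>) \<Rightarrow> f x * wave \<xi> x * h \<xi>)"
    proof (rule AE_I2)
      fix x
      have "integrable lborel (\<lambda>\<xi>. f x * (h \<xi> * wave x \<xi>))"
        by (intro integrable_mult_right integrable_mult_wave h)
      then show "integrable lborel (\<lambda>\<xi>. case (x, \<xi>) of (x, \<xi>) \<Rightarrow> f x * wave \<xi> x * h \<xi>)"
        by (simp add: wave_commute[of _ x] mult_ac)
    qed
  qed
  note swap = lborel_pair.Fubini_integral[OF this]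
  have "(LINT \<xi>|lborel. fourier_transform f \<xi> * h \<xi>) = (LINT \<xi>|lborel. LINT x|lborel. f x * wave \<xi> x * h \<xi>)"
    unfolding fourier_transform_wave by simp
  also have "\<dots> = (LINT x|lborel. LINT \<xi>|lborel. f x * wave \<xi> x * h \<xi>)"
    by (rule swap)
  also have "\<dots> = (LINT x|lborel. f x * fourier_transform h x)"
  proof (rule Bochner_Integration.integral_cong[OF refl])
    fix x
    have "(\<lambda>\<xi>. f x * wave \<xi> x * h \<xi>) = (\<lambda>\<xi>. f x * (h \<xi> * wave x \<xi>))"
      by (simp only: wave_commute[of _ x] mult_ac)
    then show "(LINT \<xi>|lborel. f x * wave \<xi> x * h \<xi>) = f x * fourier_transform h x"
      by (simp add: fourier_transform_wave)
  qed
  finally show ?thesis .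
qed

text \<open>
  The integral of the transform of \<open>f\<close> against a character is the limit, as \<open>r\<close> tends to \<open>0\<close>, of the
  integrals with an additional Gaussian factor \<open>exp (- \<pi> r\<^sup>2 (norm \<xi>)\<^sup>2)\<close>. By the multiplication
  formula these are integrals of \<open>f\<close> against the transform of the factor, which is a Gaussian
  of total mass \<open>1\<close> concentrating at \<open>- x\<close>.
\<close>

theorem fourier_inversion:
  fixes f :: "'a::euclidean_space \<Rightarrow> complex"
  assumes f: "f \<in> schwartz"
  shows "fourier_transform (fourier_transform f) x = f (- x)"
proof -
  define g where "g a z = complex_of_real (exp (- (pi * a) * (norm z)\<^sup>2))" for a :: real and z :: 'a
  define r where "r n = inverse (real (Suc n))" for n
  have r: "r n > 0" for n by (simp add: r_def)
  have r0: "r \<longlonglongrightarrow> 0" unfolding r_def by (rule LIMSEQ_inverse_real_of_nat)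
  have [measurable]: "g a \<in> borel_measurable borel" for a unfolding g_def by measurable
  have [measurable]: "f \<in> borel_measurable borel" "fourier_transform f \<in> borel_measurable borel"
    by (intro schwartz_measurable schwartz_fourier_transform f)+
  have int_g: "has_bochner_integral lborel (g 1) 1"
    using fourier_integral_gaussian[of pi "0::'a"] unfolding g_def[abs_def] by (simp add: wave_def)
  have norm_g: "norm (g a z) \<le> 1" if "a \<ge> 0" for a z
    using that by (simp add: g_def)
  have gauss: "has_bochner_integral lborel (\<lambda>\<xi>. g ((r n)\<^sup>2) \<xi> * wave x \<xi> * wave y \<xi>)
      (g 1 ((x + y) /\<^sub>R r n) /\<^sub>R r n ^ DIM('a))" for n y
  proof -
    have "pi / (pi * (r n)\<^sup>2) = (inverse (r n))\<^sup>2"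
      using r[of n] by (simp add: power_inverse divide_inverse)
    then have "sqrt (pi / (pi * (r n)\<^sup>2)) = inverse (r n)"
      using r[of n] by simp
    moreover have "pi\<^sup>2 * (norm (x + y))\<^sup>2 / (pi * (r n)\<^sup>2) = pi * (norm ((x + y) /\<^sub>R r n))\<^sup>2"
      using r[of n] by (simp add: power2_eq_square divide_inverse)
    moreover have "wave x \<xi> * wave y \<xi> = wave (x + y) \<xi>" for \<xi>
      by (metis wave_add wave_commute)
    ultimately show ?thesis
      unfolding mult.assoc
      using fourier_integral_gaussian[of "pi * (r n)\<^sup>2" "x + y"] r[of n]
      by (simp add: g_def scaleR_conv_of_real power_inverse mult.commute)
  qed
  have eq: "(LINT \<xi>|lborel. fourier_transform f \<xi> * (g ((r n)\<^sup>2) \<xi> * wave x \<xi>))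
      = (LINT z|lborel. f (- x + r n *\<^sub>R z) * g 1 z)" for n
  proof -
    have int_h: "integrable lborel (\<lambda>\<xi>. g ((r n)\<^sup>2) \<xi> * wave x \<xi>)"
      using gauss[of n 0] by (simp add: has_bochner_integral_iff wave_def)
    have ft_h: "fourier_transform (\<lambda>\<xi>. g ((r n)\<^sup>2) \<xi> * wave x \<xi>) y = g 1 ((x + y) /\<^sub>R r n) /\<^sub>R r n ^ DIM('a)" for y
      unfolding fourier_transform_wave by (rule has_bochner_integral_integral_eq[OF gauss])
    have "integrable lborel (\<lambda>y. f y * g 1 ((x + y) /\<^sub>R r n))"
      by (rule Bochner_Integration.integrable_bound[OF schwartz_integrable[OF f]])
        (auto simp: norm_mult intro!: AE_I2 mult_left_le norm_g)
    from has_bochner_integral_lborel_affine[OF _ has_bochner_integral_integrable[OF this], of "r n" "- x"] r[of n]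
    have "(LINT z|lborel. f (- x + r n *\<^sub>R z) * g 1 z) = (LINT y|lborel. f y * g 1 ((x + y) /\<^sub>R r n)) /\<^sub>R r n ^ DIM('a)"
      by (simp add: has_bochner_integral_iff)
    also have "\<dots> = (LINT y|lborel. f y * (g 1 ((x + y) /\<^sub>R r n) /\<^sub>R r n ^ DIM('a)))"
      by (simp flip: integral_scaleR_right)
    finally show ?thesis
      unfolding fourier_transform_multiplication[OF schwartz_integrable[OF f] int_h] ft_h by simp
  qed
  have "(\<lambda>n. LINT \<xi>|lborel. fourier_transform f \<xi> * (g ((r n)\<^sup>2) \<xi> * wave x \<xi>))
      \<longlonglongrightarrow> (LINT \<xi>|lborel. fourier_transform f \<xi> * (1 * wave x \<xi>))"
  proof (rule integral_dominated_convergence)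
    show "integrable lborel (\<lambda>\<xi>. cmod (fourier_transform f \<xi>))"
      by (intro integrable_norm schwartz_integrable schwartz_fourier_transform f)
    have "(\<lambda>n. g ((r n)\<^sup>2) \<xi>) \<longlonglongrightarrow> 1" for \<xi>
    proof -
      have "(\<lambda>n. g ((r n)\<^sup>2) \<xi>) \<longlonglongrightarrow> g (0\<^sup>2) \<xi>"
        unfolding g_def by (intro tendsto_intros r0)
      then show ?thesis by (simp add: g_def)
    qed
    then show "AE \<xi> in lborel. (\<lambda>n. fourier_transform f \<xi> * (g ((r n)\<^sup>2) \<xi> * wave x \<xi>))
        \<longlonglongrightarrow> fourier_transform f \<xi> * (1 * wave x \<xi>)"
      by (intro AE_I2 tendsto_intros)
    show "AE \<xi> in lborel. norm (fourier_transform f \<xi> * (g ((r n)\<^sup>2) \<xi> * wave x \<xi>)) \<le> cmod (fourier_transform f \<xi>)" for n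
      by (auto simp: norm_mult intro!: AE_I2 mult_left_le norm_g)
  qed auto
  then have lim: "(\<lambda>n. LINT z|lborel. f (- x + r n *\<^sub>R z) * g 1 z) \<longlonglongrightarrow> fourier_transform (fourier_transform f) x"
    by (simp add: eq fourier_transform_wave[of _ x])
  obtain B where B: "\<And>y. norm y ^ 0 * cmod (f y) \<le> B"
    using schwartz_bounded[OF f, of 0] unfolding bdd_above_range_iff by blast
  have lim': "(\<lambda>n. LINT z|lborel. f (- x + r n *\<^sub>R z) * g 1 z) \<longlonglongrightarrow> (LINT z|lborel. f (- x) * g 1 z)"
  proof (rule integral_dominated_convergence)
    show "integrable lborel (\<lambda>z. B * norm (g 1 z))"
      using int_g by (intro integrable_mult_right integrable_norm) (simp add: has_bochner_integral_iff)
    have "(\<lambda>n. f (- x + r n *\<^sub>R z)) \<longlonglongrightarrow> f (- x)" for z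
    proof (rule isCont_tendsto_compose[of "- x" f])
      show "isCont f (- x)"
        using schwartz_continuous[OF f, of UNIV] by (simp add: continuous_on_eq_continuous_at)
      have "(\<lambda>n. - x + r n *\<^sub>R z) \<longlonglongrightarrow> - x + 0 *\<^sub>R z"
        by (intro tendsto_intros r0)
      then show "(\<lambda>n. - x + r n *\<^sub>R z) \<longlonglongrightarrow> - x" by simp
    qed
    then show "AE z in lborel. (\<lambda>n. f (- x + r n *\<^sub>R z) * g 1 z) \<longlonglongrightarrow> f (- x) * g 1 z"
      by (intro AE_I2 tendsto_intros)
    show "AE z in lborel. norm (f (- x + r n *\<^sub>R z) * g 1 z) \<le> B * norm (g 1 z)" for n
      using B by (auto simp: norm_mult intro!: AE_I2 mult_right_mono)
  qed auto
  have "(LINT z|lborel. f (- x) * g 1 z) = f (- x)"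
    using int_g by (simp add: has_bochner_integral_iff)
  with LIMSEQ_unique[OF lim lim'] show ?thesis by simp
qed

text \<open>
  Inversion applied twice reflects twice. The point is that \<open>f\<close> is thereby the transform of a
  Schwartz function, so the transform maps the Schwartz space onto itself.
\<close>

lemma fourier_transform_four_times:
  assumes "f \<in> schwartz"
  shows "fourier_transform (fourier_transform (fourier_transform (fourier_transform f))) = f"
  using assms by (intro ext) (simp add: fourier_inversion schwartz_fourier_transform)

section \<open>Integrable functions as tempered distributions\<close>

lemma schwartz_seminorm_zero [simp]: "schwartz_seminorm k bs (\<lambda>x. 0) = 0"
proof -
  have "iter_partial bs (\<lambda>x::'a. 0) = (\<lambda>x. 0)"
    by (induction bs) (simp_all add: frechet_derivative_const)
  then show ?thesis by (simp add: schwartz_seminorm_def)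
qed

lemma openin_schwartz_ball:
  assumes "set bs \<subseteq> Basis" "f \<in> schwartz" "e > 0"
  shows "openin schwartz_topology {g \<in> schwartz. schwartz_seminorm k bs (\<lambda>x. g x - f x) < e}"
  unfolding schwartz_topology_def
  by (rule topology_generated_by_Basis, rule CollectI)
    (intro exI[of _ k] exI[of _ bs] exI[of _ f] exI[of _ e] conjI refl assms)

lemma topspace_schwartz_topology: "topspace schwartz_topology = schwartz"
proof
  show "topspace schwartz_topology \<subseteq> (schwartz :: ('a \<Rightarrow> complex) set)"
    unfolding schwartz_topology_def topology_generated_by_topspace by blast
  show "schwartz \<subseteq> topspace (schwartz_topology :: ('a \<Rightarrow> complex) topology)"
  proof
    fix f :: "'a \<Rightarrow> complex" assume f: "f \<in> schwartz"
    have "f \<in> {g \<in> schwartz. schwartz_seminorm 0 [] (\<lambda>x. g x - f x) < 1}"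
      using f by simp
    then show "f \<in> topspace schwartz_topology"
      using openin_subset[OF openin_schwartz_ball[of "[]" f 1 0]] f by auto
  qed
qed

lemma norm_le_schwartz_seminorm: "f \<in> schwartz \<Longrightarrow> cmod (f x) \<le> schwartz_seminorm 0 [] f"
  using schwartz_bounded[of f 0] unfolding schwartz_seminorm_def by (auto intro: cSUP_upper)

lemma integrable_mult_schwartz:
  fixes u f :: "'a::euclidean_space \<Rightarrow> complex"
  assumes u: "integrable lborel u" and f: "f \<in> schwartz"
  shows "integrable lborel (\<lambda>x. u x * f x)"
proof (rule Bochner_Integration.integrable_bound)
  show "integrable lborel (\<lambda>x. cmod (u x) * schwartz_seminorm 0 [] f)"
    using u by simp
  show "AE x in lborel. norm (u x * f x) \<le> norm (cmod (u x) * schwartz_seminorm 0 [] f)"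
    using norm_le_schwartz_seminorm[OF f]
    by (auto intro!: AE_I2 mult_left_mono intro: order_trans[OF _ abs_ge_self] simp: norm_mult abs_mult)
qed (use u schwartz_measurable[OF f] in auto)

text \<open>
  By linearity, continuity reduces to the bound of the functional by the total mass of \<open>u\<close> times
  the supremum seminorm.
\<close>

lemma tempered_induced_distribution:
  fixes u :: "'a::euclidean_space \<Rightarrow> complex"
  assumes u: "integrable lborel u"
  shows "tempered_distribution (induced_distribution u)"
  unfolding tempered_distribution_def
proof (intro conjI ballI allI)
  let ?T = "induced_distribution u"
  show "?T \<in> extensional schwartz"
    unfolding induced_distribution_def by (rule restrict_extensional)
  fix f g :: "'a \<Rightarrow> complex" and a b
  assume fg: "f \<in> schwartz" "g \<in> schwartz"
  have "(\<lambda>x. u x * (a * f x + b * g x)) = (\<lambda>x. a * (u x * f x) + b * (u x * g x))"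
    by (auto simp: algebra_simps)
  then show "?T (\<lambda>x. a * f x + b * g x) = a * ?T f + b * ?T g"
    using fg by (simp add: induced_distribution_def schwartz_linear_combination integrable_mult_schwartz[OF u])
next
  let ?T = "induced_distribution u"
  define N where "N = (LINT x|lborel. cmod (u x))"
  have N: "N \<ge> 0" unfolding N_def by simp
  have bound: "cmod (?T g - ?T f) \<le> N * schwartz_seminorm 0 [] (\<lambda>x. g x - f x)"
    if fg: "f \<in> schwartz" "g \<in> schwartz" for f g
  proof -
    note d = schwartz_diff[OF fg(2,1)]
    have "?T g - ?T f = (LINT x|lborel. u x * (g x - f x))"
      using fg by (simp add: induced_distribution_def right_diff_distrib integrable_mult_schwartz[OF u])
    also have "cmod \<dots> \<le> (LINT x|lborel. cmod (u x) * schwartz_seminorm 0 [] (\<lambda>x. g x - f x))"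
    proof (rule order_trans[OF integral_norm_bound], rule integral_mono)
      show "integrable lborel (\<lambda>x. norm (u x * (g x - f x)))"
        by (intro integrable_norm integrable_mult_schwartz u d)
      show "norm (u x * (g x - f x)) \<le> cmod (u x) * schwartz_seminorm 0 [] (\<lambda>x. g x - f x)" for x
        using norm_le_schwartz_seminorm[OF d, of x] by (auto simp: norm_mult intro!: mult_left_mono)
    qed (use u in simp)
    finally show ?thesis by (simp add: N_def)
  qed
  show "continuous_map schwartz_topology euclidean ?T"
    unfolding continuous_map_def topspace_schwartz_topology
  proof (intro conjI allI impI)
    fix U :: "complex set" assume "openin euclidean U"
    then have U: "open U" by simp
    show "openin schwartz_topology {f \<in> schwartz. ?T f \<in> U}"
    proof (subst openin_subopen, intro ballI)
      fix f assume "f \<in> {f \<in> schwartz. ?T f \<in> U}"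
      then have f: "f \<in> schwartz" "?T f \<in> U" by auto
      then obtain e where e: "e > 0" "ball (?T f) e \<subseteq> U" using U open_contains_ball by blast
      \<comment> \<open>One is added to \<open>N\<close> because \<open>N\<close> may vanish.\<close>
      define B where "B = {g \<in> schwartz. schwartz_seminorm 0 [] (\<lambda>x. g x - f x) < e / (N + 1)}"
      have pos: "e / (N + 1) > 0" using e N by simp
      have "openin schwartz_topology B"
        unfolding B_def by (rule openin_schwartz_ball) (use f pos in auto)
      moreover have "f \<in> B" using f pos by (simp add: B_def)
      moreover have "B \<subseteq> {f \<in> schwartz. ?T f \<in> U}"
      proof safe
        fix g assume "g \<in> B"
        then have g: "g \<in> schwartz" "schwartz_seminorm 0 [] (\<lambda>x. g x - f x) < e / (N + 1)"
          by (auto simp: B_def)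
        then show "g \<in> schwartz" by simp
        have "cmod (?T g - ?T f) \<le> N * (e / (N + 1))"
          by (rule order_trans[OF bound[OF f(1) g(1)]]) (intro mult_left_mono less_imp_le g N)
        also have "\<dots> < e" using N e by (simp add: field_simps)
        finally show "?T g \<in> U" using e(2) by (auto simp: dist_norm norm_minus_commute)
      qed
      ultimately show "\<exists>B. openin schwartz_topology B \<and> f \<in> B \<and> B \<subseteq> {f \<in> schwartz. ?T f \<in> U}"
        by blast
    qed
  qed auto
qed

lemma fourier_distribution_induced:
  assumes u: "integrable lborel u"
  shows "fourier_distribution (induced_distribution u) = induced_distribution (fourier_transform u)"
  unfolding fourier_distribution_def induced_distribution_def
proof (rule restrict_ext)
  fix f :: "'a \<Rightarrow> complex" assume f: "f \<in> schwartz"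
  show "(\<lambda>f\<in>schwartz. LINT x|lborel. u x * f x) (fourier_transform f) = (LINT x|lborel. fourier_transform u x * f x)"
    using fourier_transform_multiplication[OF u schwartz_integrable[OF f]]
    by (simp add: schwartz_fourier_transform f)
qed

text \<open>
  Two distributions with the same Fourier transform agree on transforms of Schwartz functions,
  that is, on all Schwartz functions.
\<close>

lemma fourier_distribution_inj:
  assumes "K \<in> extensional schwartz" "L \<in> extensional schwartz"
    and eq: "fourier_distribution K = fourier_distribution L"
  shows "K = L"
proof (rule extensionalityI[OF assms(1,2)])
  fix f :: "'a \<Rightarrow> complex" assume f: "f \<in> schwartz"
  define g where "g = fourier_transform (fourier_transform (fourier_transform f))"
  have "g \<in> schwartz" unfolding g_def by (intro schwartz_fourier_transform f)
  moreover have "fourier_transform g = f" unfolding g_def by (rule fourier_transform_four_times[OF f])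
  ultimately show "K f = L f"
    using fun_cong[OF eq, of g] by (simp add: fourier_distribution_def)
qed

section \<open>Mixtures of kernels with known Fourier integrals\<close>

text \<open>
  Integrating a family of nonnegative kernels over a parameter integrates their Fourier transforms.
  Nonnegativity makes \<open>m 0 u\<close> the \<open>L\<^sup>1\<close> norm of the kernel \<open>H u\<close>, so that integrability of \<open>m 0\<close> is
  all that Fubini's theorem requires.
\<close>

lemma fourier_integral_mixture:
  fixes H :: "real \<Rightarrow> 'a::euclidean_space \<Rightarrow> real" and m :: "'a \<Rightarrow> real \<Rightarrow> real"
  assumes H_meas: "(\<lambda>(u, x). H u x) \<in> borel_measurable (borel \<Otimes>\<^sub>M borel)"
    and A [measurable]: "A \<in> sets borel"
    and nonneg: "\<And>u x. u \<in> A \<Longrightarrow> 0 \<le> H u x"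
    and H: "\<And>u \<xi>. u \<in> A \<Longrightarrow>
      has_bochner_integral lborel (\<lambda>x. complex_of_real (H u x) * wave \<xi> x) (complex_of_real (m \<xi> u))"
    and m0: "set_integrable lborel A (m 0)"
  shows "has_bochner_integral lborel (\<lambda>x. complex_of_real (LINT u:A|lborel. H u x) * wave \<xi> x)
           (complex_of_real (LINT u:A|lborel. m \<xi> u))"
proof -
  have [measurable]: "(\<lambda>p. H (fst p) (snd p)) \<in> borel_measurable (borel \<Otimes>\<^sub>M borel)"
    using H_meas by (simp add: case_prod_unfold)
  define F where "F u x = complex_of_real (indicator A u * H u x) * wave \<xi> x" for u x
  have F_int: "integrable lborel (F u)" for u
    using H[of u \<xi>] by (cases "u \<in> A") (auto simp: F_def[abs_def] has_bochner_integral_iff)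
  \<comment> \<open>The transform of a nonnegative function at the origin is its \<open>L\<^sup>1\<close> norm.\<close>
  have norm_F: "(LINT x|lborel. norm (F u x)) = indicator A u *\<^sub>R m 0 u" for u
  proof (cases "u \<in> A")
    case True
    have "(LINT x|lborel. complex_of_real (H u x)) = complex_of_real (m 0 u)"
      using H[OF True, of 0] by (simp add: has_bochner_integral_iff wave_def)
    then have "(LINT x|lborel. H u x) = m 0 u"
      by (simp only: integral_complex_of_real of_real_eq_iff)
    then show ?thesis using True nonneg[OF True] by (simp add: F_def norm_mult)
  qed (simp add: F_def)
  have int: "integrable (lborel \<Otimes>\<^sub>M lborel) (case_prod F)"
  proof (rule lborel_pair.Fubini_integrable)
    show "case_prod F \<in> borel_measurable (lborel \<Otimes>\<^sub>M lborel)"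
      unfolding F_def case_prod_unfold by measurable
    show "integrable lborel (\<lambda>u. LINT x|lborel. norm (case_prod F (u, x)))"
      using m0 by (simp add: norm_F set_integrable_def)
    show "AE u in lborel. integrable lborel (\<lambda>x. case_prod F (u, x))"
      using F_int by simp
  qed
  have F_u: "(LINT u|lborel. F u x) = complex_of_real (LINT u:A|lborel. H u x) * wave \<xi> x" for x
    unfolding F_def set_lebesgue_integral_def integral_mult_left_zero integral_complex_of_real by simp
  have F_x: "(LINT x|lborel. F u x) = complex_of_real (indicator A u *\<^sub>R m \<xi> u)" for u
    using H[of u \<xi>] by (cases "u \<in> A") (auto simp: F_def has_bochner_integral_iff)
  from lborel_pair.integrable_snd[OF int] lborel_pair.Fubini_integral[OF int]
  show ?thesis
    unfolding F_u F_x integral_complex_of_real set_lebesgue_integral_def[of lborel A "m \<xi>"]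
    by (simp add: has_bochner_integral_iff)
qed

lemma has_bochner_integral_Gamma_scaled:
  fixes \<alpha> c :: real
  assumes \<alpha>: "\<alpha> > 0" and c: "c > 0"
  shows "has_bochner_integral lborel (\<lambda>t. indicator {0<..} t *\<^sub>R (exp (- c * t) * t powr (\<alpha> - 1)))
           (Gamma \<alpha> * c powr - \<alpha>)"
proof -
  have "has_bochner_integral lborel (\<lambda>t. indicator {0..} t * t powr (\<alpha> - 1) / exp t) (Gamma \<alpha>)"
    by (rule has_bochner_integral_nn_integral)
      (use \<alpha> Gamma_real_pos[OF \<alpha>] in \<open>auto simp flip: Gamma_conv_nn_integral_real\<close>)
  from has_bochner_integral_mult_right[OF has_bochner_integral_lborel_affine[OF _ this, of c 0], of "c powr (1 - \<alpha>)"] c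
  have "has_bochner_integral lborel
      (\<lambda>t. c powr (1 - \<alpha>) * (indicator {0..} (c * t) * (c * t) powr (\<alpha> - 1) / exp (c * t)))
      (c powr (1 - \<alpha>) * (Gamma \<alpha> / c))"
    by (simp add: divide_inverse mult_ac)
  moreover have "c powr (1 - \<alpha>) * (indicator {0..} (c * t) * (c * t) powr (\<alpha> - 1) / exp (c * t))
      = indicator {0<..} t *\<^sub>R (exp (- c * t) * t powr (\<alpha> - 1))" for t
  proof (cases "t > 0")
    case True
    then show ?thesis using c
      by (simp add: powr_mult exp_minus divide_inverse powr_add[symmetric] flip: mult.assoc)
  next
    case False
    then show ?thesis using c by (cases "t = 0") (auto simp: indicator_def zero_le_mult_iff)
  qed
  moreover have "c powr (1 - \<alpha>) * (Gamma \<alpha> / c) = Gamma \<alpha> * c powr - \<alpha>"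
    using c by (simp add: powr_diff powr_minus field_simps)
  ultimately show ?thesis by simp
qed

text \<open>
  This is where the logarithm comes from: the antiderivative of \<open>c powr - \<alpha>\<close> in the exponent \<open>\<alpha>\<close> is
  \<open>- c powr - \<alpha> / ln c\<close>.
\<close>

lemma has_bochner_integral_powr_exponent:
  fixes c s :: real
  assumes c: "c > 1"
  shows "has_bochner_integral lborel (\<lambda>\<alpha>. indicator {s<..} \<alpha> *\<^sub>R c powr - \<alpha>) (1 / (c powr s * ln c))"
proof -
  have lnc: "ln c > 0" using c by simp
  have eq: "c powr - \<alpha> = exp (- ln c * \<alpha>)" for \<alpha> using c by (simp add: powr_def mult.commute)
  have "((\<lambda>\<alpha>. c powr - \<alpha>) has_integral exp (- ln c * s) / ln c) {s..}"
    unfolding eq by (rule has_integral_exp_minus_to_infinity[OF lnc])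
  from nn_integral_has_integral_lebesgue[OF _ this]
  have "(\<integral>\<^sup>+ \<alpha>. ennreal (indicator {s..} \<alpha> * c powr - \<alpha>) \<partial>lborel) = ennreal (exp (- ln c * s) / ln c)"
    by simp
  then have "has_bochner_integral lborel (\<lambda>\<alpha>. indicator {s..} \<alpha> * c powr - \<alpha>) (exp (- ln c * s) / ln c)"
    using lnc by (intro has_bochner_integral_nn_integral) auto
  then have "has_bochner_integral lborel (\<lambda>\<alpha>. indicator {s<..} \<alpha> *\<^sub>R c powr - \<alpha>) (exp (- ln c * s) / ln c)"
  proof (rule has_bochner_integral_cong_AE[THEN iffD1, rotated 3])
    show "AE \<alpha> in lborel. indicator {s..} \<alpha> * c powr - \<alpha> = indicator {s<..} \<alpha> *\<^sub>R c powr - \<alpha>"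
      using AE_lborel_singleton[of s] by eventually_elim (auto simp: indicator_def)
  qed measurable
  moreover have "exp (- ln c * s) / ln c = 1 / (c powr s * ln c)"
    unfolding eq[of s, symmetric] powr_minus by (simp add: divide_inverse)
  ultimately show ?thesis by simp
qed

section \<open>Heat kernel, Bessel kernels and their mixture\<close>

lemma heat_kernel_nonneg: "heat_kernel t x \<ge> 0"
  by (simp add: heat_kernel_def)

lemma measurable_heat_kernel [measurable (raw)]:
  assumes [measurable]: "f \<in> borel_measurable M" "g \<in> borel_measurable M"
  shows "(\<lambda>p. heat_kernel (f p) (g p)) \<in> borel_measurable M"
  unfolding heat_kernel_def by measurable

text \<open>
  Away from the origin the Gaussian factor beats the singularity at \<open>t = 0\<close>. Writing the kernel as
  a power with exponent \<open>n / 2\<close> reduces this to \<open>exp (- v) \<le> 1 / v\<close>.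
\<close>

lemma heat_kernel_bounded:
  fixes x :: "'a::euclidean_space"
  assumes x: "x \<noteq> 0"
  obtains B where "B \<ge> 0" "\<And>t. t > 0 \<Longrightarrow> heat_kernel t x \<le> B"
proof -
  define n where "n = real DIM('a)"
  have n: "n > 0" by (simp add: n_def)
  have "heat_kernel t x \<le> (n / (2 * pi * (norm x)\<^sup>2)) powr (n / 2)" if t: "t > 0" for t
  proof -
    define v where "v = (norm x)\<^sup>2 / (2 * n * t)"
    have v: "v > 0" using x n t by (simp add: v_def)
    have "exp (- (norm x)\<^sup>2 / (4 * t)) = exp (- v) powr (n / 2)"
      using n t by (simp add: exp_powr_real v_def)
    moreover have "(4 * pi * t) powr (- real DIM('a) / 2) = inverse ((4 * pi * t) powr (n / 2))"
      unfolding n_def minus_divide_left[symmetric] by (rule powr_minus)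
    ultimately have "heat_kernel t x = exp (- v) powr (n / 2) / (4 * pi * t) powr (n / 2)"
      by (simp only: heat_kernel_def divide_inverse mult.commute)
    also have "\<dots> = (exp (- v) / (4 * pi * t)) powr (n / 2)"
      using t by (simp add: powr_divide)
    also have "\<dots> \<le> (n / (2 * pi * (norm x)\<^sup>2)) powr (n / 2)"
    proof (rule powr_mono2)
      have "v \<le> exp v" using exp_ge_add_one_self[of v] by linarith
      then have "exp (- v) \<le> 1 / v"
        using v by (simp add: exp_minus field_simps)
      then have "exp (- v) / (4 * pi * t) \<le> 1 / v / (4 * pi * t)"
        using t by (intro divide_right_mono) auto
      also have "\<dots> = n / (2 * pi * (norm x)\<^sup>2)"
        using x n t by (simp add: v_def field_simps)
      finally show "exp (- v) / (4 * pi * t) \<le> n / (2 * pi * (norm x)\<^sup>2)" .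
    qed (use n t in auto)
    finally show ?thesis .
  qed
  then show ?thesis by (rule that[OF powr_ge_zero])
qed

text \<open>
  Measurability in the order is read off from the reciprocal Gamma function, which is continuous on
  the whole line.
\<close>

lemma measurable_bessel_kernel [measurable (raw)]:
  assumes [measurable]: "f \<in> borel_measurable M" "g \<in> borel_measurable M"
  shows "(\<lambda>p. bessel_kernel lam (f p) (g p)) \<in> borel_measurable M"
proof -
  have [measurable]: "(rGamma :: real \<Rightarrow> real) \<in> borel_measurable borel"
    by (intro borel_measurable_continuous_onI continuous_intros)
  have eq: "1 / Gamma \<alpha> = rGamma \<alpha>" for \<alpha> :: real by (simp add: Gamma_def inverse_eq_divide[symmetric])
  show ?thesis
    unfolding bessel_kernel_def eq set_lebesgue_integral_def by measurable
qed

lemma bessel_kernel_nonneg: "\<alpha> > 0 \<Longrightarrow> bessel_kernel lam \<alpha> x \<ge> 0"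
  unfolding bessel_kernel_def set_lebesgue_integral_def
  by (intro mult_nonneg_nonneg integral_nonneg_AE)
    (auto simp: heat_kernel_nonneg Gamma_real_pos less_imp_le)

text \<open>
  A bound of the heat kernel at \<open>x\<close> that is uniform in time can be pulled out of the Gamma integral.
\<close>

lemma bessel_kernel_integrand_bound:
  fixes x :: "'a::euclidean_space"
  assumes \<alpha>: "\<alpha> > 0" and lam: "lam > 0" and B: "\<And>t. t > 0 \<Longrightarrow> heat_kernel t x \<le> B"
  shows "set_integrable lborel {0<..} (\<lambda>t. exp (- lam * t) * t powr (\<alpha> - 1) * heat_kernel t x)"
    and "bessel_kernel lam \<alpha> x \<le> B * lam powr - \<alpha>"
proof -
  let ?w = "\<lambda>t. exp (- lam * t) * t powr (\<alpha> - 1)"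
  have w: "integrable lborel (\<lambda>t. B * (indicator {0<..} t *\<^sub>R ?w t))"
    "(LINT t|lborel. B * (indicator {0<..} t *\<^sub>R ?w t)) = B * (Gamma \<alpha> * lam powr - \<alpha>)"
    using has_bochner_integral_mult_right[OF has_bochner_integral_Gamma_scaled[OF \<alpha> lam], of B]
    by (simp_all add: has_bochner_integral_iff)
  have le: "indicator {0<..} t *\<^sub>R (?w t * heat_kernel t x) \<le> B * (indicator {0<..} t *\<^sub>R ?w t)" for t
    using mult_left_mono[OF B[of t], of "?w t"] by (auto simp: indicator_def mult_ac)
  have nonneg: "0 \<le> indicator {0<..} t *\<^sub>R (?w t * heat_kernel t x)" for t
    by (simp add: heat_kernel_nonneg)
  have int: "integrable lborel (\<lambda>t. indicator {0<..} t *\<^sub>R (?w t * heat_kernel t x))"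
  proof (rule Bochner_Integration.integrable_bound[OF w(1)])
    show "AE t in lborel. norm (indicator {0<..} t *\<^sub>R (?w t * heat_kernel t x))
        \<le> norm (B * (indicator {0<..} t *\<^sub>R ?w t))"
      unfolding real_norm_def abs_of_nonneg[OF nonneg] by (intro AE_I2 order_trans[OF le abs_ge_self])
  qed measurable
  then show "set_integrable lborel {0<..} (\<lambda>t. ?w t * heat_kernel t x)"
    by (simp add: set_integrable_def)
  have "(LINT t:{0<..}|lborel. ?w t * heat_kernel t x) \<le> B * (Gamma \<alpha> * lam powr - \<alpha>)"
    unfolding set_lebesgue_integral_def w(2)[symmetric] by (intro integral_mono int w(1) le)
  then show "bessel_kernel lam \<alpha> x \<le> B * lam powr - \<alpha>"
    unfolding bessel_kernel_def using Gamma_real_pos[OF \<alpha>] by (simp add: field_simps)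
qed

text \<open>
  At a fixed point other than the origin the Bessel kernels are dominated by a multiple of
  \<open>lam powr - \<alpha>\<close>, which is integrable at infinity because \<open>lam > 1\<close>.
\<close>

lemma bessel_kernel_set_integrable:
  fixes x :: "'a::euclidean_space"
  assumes s: "s > 0" and lam: "lam > 1" and x: "x \<noteq> 0"
  shows "set_integrable lborel {s<..} (\<lambda>\<alpha>. bessel_kernel lam \<alpha> x)"
proof -
  obtain B where B: "B \<ge> 0" "\<And>t. t > 0 \<Longrightarrow> heat_kernel t x \<le> B"
    using heat_kernel_bounded[OF x] by blast
  have "integrable lborel (\<lambda>\<alpha>. B * (indicator {s<..} \<alpha> *\<^sub>R lam powr - \<alpha>))"
    using has_bochner_integral_powr_exponent[OF lam] by (intro integrable_mult_right) (simp add: has_bochner_integral_iff)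
  then show ?thesis
    unfolding set_integrable_def
  proof (rule Bochner_Integration.integrable_bound)
    have "norm (indicator {s<..} \<alpha> *\<^sub>R bessel_kernel lam \<alpha> x) \<le> norm (B * (indicator {s<..} \<alpha> *\<^sub>R lam powr - \<alpha>))" for \<alpha>
      using bessel_kernel_integrand_bound(2)[of \<alpha> lam x B] bessel_kernel_nonneg[of \<alpha> lam x] s lam B
      by (auto simp: indicator_def abs_mult)
    then show "AE \<alpha> in lborel. norm (indicator {s<..} \<alpha> *\<^sub>R bessel_kernel lam \<alpha> x) \<le> norm (B * (indicator {s<..} \<alpha> *\<^sub>R lam powr - \<alpha>))"
      by simp
  qed measurable
qed

text \<open>
  The Bessel kernel is a mixture of heat kernels over the time \<open>t\<close>, and the Gamma integral evaluates
  the mixture of the transforms \<open>exp (- 4 \<pi>\<^sup>2 (norm \<xi>)\<^sup>2 t)\<close>.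
\<close>

lemma fourier_integral_bessel_kernel:
  fixes \<xi> :: "'a::euclidean_space"
  assumes \<alpha>: "\<alpha> > 0" and lam: "lam > 0"
  shows "has_bochner_integral lborel (\<lambda>x. complex_of_real (bessel_kernel lam \<alpha> x) * wave \<xi> x)
           (complex_of_real ((lam + 4 * pi\<^sup>2 * (norm \<xi>)\<^sup>2) powr - \<alpha>))"
proof -
  define H where "H t x = exp (- lam * t) * t powr (\<alpha> - 1) * heat_kernel t x" for t and x :: 'a
  define c where "c \<xi> = lam + 4 * pi\<^sup>2 * (norm \<xi>)\<^sup>2" for \<xi> :: 'a
  have c: "c \<xi> > 0" for \<xi> using lam by (simp add: c_def add_pos_nonneg)
  define m where "m \<xi> t = exp (- c \<xi> * t) * t powr (\<alpha> - 1)" for \<xi> :: 'a and t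
  have m: "has_bochner_integral lborel (\<lambda>t. indicator {0<..} t *\<^sub>R m \<xi> t) (Gamma \<alpha> * c \<xi> powr - \<alpha>)" for \<xi>
    unfolding m_def by (rule has_bochner_integral_Gamma_scaled[OF \<alpha> c])
  have "has_bochner_integral lborel (\<lambda>x. complex_of_real (LINT t:{0<..}|lborel. H t x) * wave \<xi> x)
           (complex_of_real (LINT t:{0<..}|lborel. m \<xi> t))"
  proof (rule fourier_integral_mixture)
    show "(\<lambda>(t, x). H t x) \<in> borel_measurable (borel \<Otimes>\<^sub>M borel)"
      unfolding H_def case_prod_unfold by measurable
    show "0 \<le> H t x" for t x by (simp add: H_def heat_kernel_nonneg)
    show "has_bochner_integral lborel (\<lambda>x. complex_of_real (H t x) * wave \<eta> x) (complex_of_real (m \<eta> t))"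
      if "t \<in> {0<..}" for t \<eta>
    proof -
      define r where "r = exp (- lam * t) * t powr (\<alpha> - 1)"
      have "m \<eta> t = r * exp (- (4 * pi\<^sup>2 * (norm \<eta>)\<^sup>2) * t)"
        by (simp add: m_def r_def c_def algebra_simps exp_diff exp_minus divide_inverse)
      then show ?thesis
        using has_bochner_integral_mult_right[OF fourier_integral_heat_kernel[of t \<eta>], of "of_real r"] that
        by (simp only: H_def r_def[symmetric] of_real_mult mult.assoc greaterThan_iff)
    qed
    show "set_integrable lborel {0<..} (m 0)"
      using m[of 0] by (simp add: set_integrable_def has_bochner_integral_iff)
  qed simp
  also have "(LINT t:{0<..}|lborel. m \<xi> t) = Gamma \<alpha> * c \<xi> powr - \<alpha>"
    using m[of \<xi>] by (simp add: set_lebesgue_integral_def has_bochner_integral_iff)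
  finally have "has_bochner_integral lborel
      (\<lambda>x. of_real (1 / Gamma \<alpha>) * (complex_of_real (LINT t:{0<..}|lborel. H t x) * wave \<xi> x))
      (of_real (1 / Gamma \<alpha>) * complex_of_real (Gamma \<alpha> * c \<xi> powr - \<alpha>))"
    by (intro has_bochner_integral_mult_right)
  moreover have "of_real (1 / Gamma \<alpha>) * complex_of_real (Gamma \<alpha> * c \<xi> powr - \<alpha>) = complex_of_real (c \<xi> powr - \<alpha>)"
    using Gamma_real_pos[OF \<alpha>] by simp
  ultimately show ?thesis
    by (simp only: bessel_kernel_def H_def of_real_mult mult.assoc c_def)
qed

definition log_bessel_function :: "real \<Rightarrow> real \<Rightarrow> 'a::euclidean_space \<Rightarrow> real" where
  "log_bessel_function s lam x = (LINT \<alpha>:{s<..}|lborel. bessel_kernel lam \<alpha> x)"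

text \<open>
  A second mixture, of the Bessel kernels over their order \<open>\<alpha>\<close>.
\<close>

lemma fourier_integral_log_bessel:
  fixes \<xi> :: "'a::euclidean_space"
  assumes s: "s > 0" and lam: "lam > 1"
  shows "has_bochner_integral lborel
      (\<lambda>x. complex_of_real (log_bessel_function s lam x) * wave \<xi> x)
      (complex_of_real (log_bessel_symbol s lam \<xi>))"
proof -
  define m where "m \<xi> \<alpha> = (lam + 4 * pi\<^sup>2 * (norm \<xi>)\<^sup>2) powr - \<alpha>" for \<xi> :: 'a and \<alpha>
  have m: "has_bochner_integral lborel (\<lambda>\<alpha>. indicator {s<..} \<alpha> *\<^sub>R m \<xi> \<alpha>) (log_bessel_symbol s lam \<xi>)" for \<xi>
    unfolding m_def log_bessel_symbol_def
  proof (rule has_bochner_integral_powr_exponent)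
    have "0 \<le> 4 * pi\<^sup>2 * (norm \<xi>)\<^sup>2" by simp
    with lam show "1 < lam + 4 * pi\<^sup>2 * (norm \<xi>)\<^sup>2" by linarith
  qed
  have "has_bochner_integral lborel (\<lambda>x. complex_of_real (LINT \<alpha>:{s<..}|lborel. bessel_kernel lam \<alpha> x) * wave \<xi> x)
           (complex_of_real (LINT \<alpha>:{s<..}|lborel. m \<xi> \<alpha>))"
  proof (rule fourier_integral_mixture)
    show "(\<lambda>(\<alpha>, x). bessel_kernel lam \<alpha> x) \<in> borel_measurable (borel \<Otimes>\<^sub>M (borel :: 'a measure))"
      unfolding case_prod_unfold by measurable
    show "0 \<le> bessel_kernel lam \<alpha> x" if "\<alpha> \<in> {s<..}" for \<alpha> and x :: 'a
      using that s by (intro bessel_kernel_nonneg) simp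
    show "has_bochner_integral lborel (\<lambda>x. complex_of_real (bessel_kernel lam \<alpha> x) * wave \<eta> x)
        (complex_of_real (m \<eta> \<alpha>))" if "\<alpha> \<in> {s<..}" for \<alpha> \<eta>
      unfolding m_def using that s lam by (intro fourier_integral_bessel_kernel) auto
    show "set_integrable lborel {s<..} (m 0)"
      using m[of 0] by (simp add: set_integrable_def has_bochner_integral_iff)
  qed simp
  also have "(LINT \<alpha>:{s<..}|lborel. m \<xi> \<alpha>) = log_bessel_symbol s lam \<xi>"
    using m[of \<xi>] by (simp add: set_lebesgue_integral_def has_bochner_integral_iff)
  finally show ?thesis unfolding log_bessel_function_def .
qed

text \<open>
  Injectivity of the Fourier transform on distributions makes the defining description of the kernel
  definite, and an integrable function with the right Fourier transform satisfies it.
\<close>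

lemma log_bessel_kernel_eq_induced:
  fixes u :: "'a::euclidean_space \<Rightarrow> complex"
  assumes u: "integrable lborel u"
    and ft: "fourier_transform u = (\<lambda>\<xi>. complex_of_real (log_bessel_symbol s lam \<xi>))"
  shows "log_bessel_kernel s lam = induced_distribution u"
  unfolding log_bessel_kernel_def
proof (rule the_equality)
  let ?S = "induced_distribution (\<lambda>\<xi>. complex_of_real (log_bessel_symbol s lam \<xi>))"
  have tempered: "tempered_distribution (induced_distribution u)"
    by (rule tempered_induced_distribution[OF u])
  have fourier: "fourier_distribution (induced_distribution u) = ?S"
    by (simp only: fourier_distribution_induced[OF u] ft)
  show "tempered_distribution (induced_distribution u) \<and> fourier_distribution (induced_distribution u) = ?S"
    using tempered fourier ..
  fix K :: "('a \<Rightarrow> complex) \<Rightarrow> complex"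
  assume K: "tempered_distribution K \<and> fourier_distribution K = ?S"
  show "K = induced_distribution u"
  proof (rule fourier_distribution_inj)
    show "K \<in> extensional schwartz" "induced_distribution u \<in> extensional schwartz"
      using K tempered by (simp_all only: tempered_distribution_def)
    show "fourier_distribution K = fourier_distribution (induced_distribution u)"
      using K by (simp only: fourier)
  qed
qed

theorem proposition1p2:
  fixes s lam :: real
  assumes "s > 0" and "lam > 1"
  shows
    "(\<forall>x::real^'n. x \<noteq> 0 \<longrightarrow>
        (\<forall>\<alpha>>s. set_integrable lborel {0<..}
           (\<lambda>t. exp (- lam * t) * t powr (\<alpha> - 1) * heat_kernel t x)) \<and>
        set_integrable lborel {s<..} (\<lambda>\<alpha>. bessel_kernel lam \<alpha> x)) \<and>
     integrable lborel (\<lambda>x::real^'n. LINT \<alpha>:{s<..}|lborel. bessel_kernel lam \<alpha> x) \<and>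
     log_bessel_kernel s lam =
       induced_distribution
         (\<lambda>x::real^'n. complex_of_real (LINT \<alpha>:{s<..}|lborel. bessel_kernel lam \<alpha> x)) \<and>
     log_bessel_kernel s lam =
       induced_distribution
         (\<lambda>x::real^'n. complex_of_real (LINT \<alpha>:{s<..}|lborel. 1 / Gamma \<alpha> *
            (LINT t:{0<..}|lborel. exp (- lam * t) * t powr (\<alpha> - 1) * heat_kernel t x)))"
proof -
  have pointwise: "set_integrable lborel {0<..} (\<lambda>t. exp (- lam * t) * t powr (\<alpha> - 1) * heat_kernel t x)"
    if "x \<noteq> 0" "\<alpha> > s" for x :: "real^'n" and \<alpha>
  proof -
    obtain B where "\<And>t. t > 0 \<Longrightarrow> heat_kernel t x \<le> B"
      using heat_kernel_bounded[OF \<open>x \<noteq> 0\<close>] by blast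
    then show ?thesis using that assms by (intro bessel_kernel_integrand_bound(1)) auto
  qed
  note ft = fourier_integral_log_bessel[OF assms, where 'a = "real^'n"]
  have int: "integrable lborel (\<lambda>x::real^'n. complex_of_real (log_bessel_function s lam x))"
    using ft[of 0] by (simp add: has_bochner_integral_iff wave_def)
  have "fourier_transform (\<lambda>x::real^'n. complex_of_real (log_bessel_function s lam x))
      = (\<lambda>\<xi>. complex_of_real (log_bessel_symbol s lam \<xi>))"
    unfolding fourier_transform_wave[abs_def] using ft by (simp add: has_bochner_integral_iff)
  from log_bessel_kernel_eq_induced[OF int this]
  have kernel: "log_bessel_kernel s lam = induced_distribution
      (\<lambda>x::real^'n. complex_of_real (LINT \<alpha>:{s<..}|lborel. bessel_kernel lam \<alpha> x))"
    unfolding log_bessel_function_def .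
  have "integrable lborel (\<lambda>x::real^'n. LINT \<alpha>:{s<..}|lborel. bessel_kernel lam \<alpha> x)"
    using int unfolding log_bessel_function_def complex_of_real_integrable_eq .
  then show ?thesis
    using pointwise bessel_kernel_set_integrable[OF assms] kernel kernel[unfolded bessel_kernel_def]
    by (intro conjI allI impI)
qed

end
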